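(* Let $\mathbf H$ be a finite connected ordered hypergraph and let $S,T$ be two constructions of $\mathbf H$. Then: (1) If $S\lessdot_{\mathrm{flip}}T$, then $S\lessdot^+T$. (2) If $\mathbf H$ is hereditarily ordered and $S\lessdot^+T$, then $S\lessdot_{\mathrm{flip}}^+T$. Here $^+$ denotes transitive closure (of $\lessdot$ on the set of all constructs of $\mathbf H$, and of $\lessdot_{\mathrm{flip}}$ on the set of all constructions of $\mathbf H$, respectively).
   Context: A (finite) hypergraph $\mathbf H$ with finite vertex set $H$ is a set of non-empty subsets of $H$ (hyperedges) with $\bigcup\mathbf H=H$ and $\{x\}\in\mathbf H$ for all $x\in H$. For $X\subseteq H$, $\mathbf H_X:=\{Z\in\mathbf H: Z\subseteq X\}$ and $\mathbf H\setminus X:=\mathbf H_{H\setminus X}$. $\mathbf H$ is connected if there is no partition $H=X_1\cup X_2$ into two non-empty parts with $\mathbf H=\mathbf H_{X_1}\cup\mathbf H_{X_2}$. Every hypergraph is uniquely the union of its connected components; $\mathbf H,X\leadsto H_1,\dots,H_n$ means that $\mathbf H_{H_1},\dots,\mathbf H_{H_n}$ are the connected components of $\mathbf H\setminus X$. Constructs of a connected hypergraph $\mathbf H$ are non-planar rooted trees with nodes labelled by non-empty subsets of $H$, defined recursively: the one-node tree labelled $H$ is a construct of $\mathbf H$; if $\emptyset\neq Y\subsetneq H$, $\mathbf H,Y\leadsto H_1,\dots,H_n$, and $T_i$ is a construct of $\mathbf H_{H_i}$ for each $i$, then the tree $Y(T_1,\dots,T_n)$ with root $Y$ and immediate subtrees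 $T_1,\dots,T_n$ is a construct of $\mathbf H$. Nodes are identified with their labels (the labels partition $H$). A construction is a construct all of whose nodes are singletons. $\mathbf H$ is ordered if $H$ carries a total order; for non-empty $Y,Z\subseteq H$, $Y<Z$ (or $Z>Y$) means $\max Y<\min Z$. An ordered $\mathbf H$ is hereditarily ordered if for every non-empty $X\subseteq H$ the components in $\mathbf H,X\leadsto H_1,\dots,H_n$ can be indexed so that $H_1<H_2<\cdots<H_n$. If in a construct $S$ the node $X$ is the parent of the node $Y$, contracting the edge between them and labelling the merged node $X\cup Y$ yields a construct $T$; write $S\subset_{X,Y}T$. For constructs $S,S'$ of $\mathbf H$, $S\lessdot S'$ iff there exist $U,V$ with $U>V$ such that either $S\subset_{U,V}S'$ (fusion) or $S'\subset_{V,U}S$ (split). Flips: let $S$ be a construction of $\mathbf H$ with $\{x\}$ the parent of $\{y\}$ and $y<x$. Let $G$ be the union of the labels of $\{x\}$ and all its descendants in $S$, and $\mathbf G=\mathbf H_G$. The subtree of $S$ rooted at $\{x\}$ consists of $x$, its child $y$, and, for each connected component $C$ of $\mathbf G\setminus\{x,y\}$, a construction $S_C$ of $\mathbf G_C$ (attached to $x$ or to $y$). $\mathsf{Flip}_S(x,y)$ is obtained from $S$ by replacing this subtree with the one having root $\{y\}$, whose children are: a node $\{x\}$, carrying as immediate subtrees those $S_C$ with $C$ contained in the connected component of $\mathbf G\setminus\{y\}$ containing $x$; and all the remaining $S_C$. For constructions $S,T$, $S\lessdot_{\mathrm{flip}}T$ iff $T=\mathsf{Flip}_S(x,y)$ for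 some such $x,y$. *)

theory Defs
  imports Main "HOL-Library.FSet" "HOL-Library.Disjoint_Sets"
begin

section \<open>Hypergraphs\<close>

text \<open>A hypergraph is represented by its set of hyperedges; its vertex set is \<open>\<Union>H\<close>.\<close>

definition hypergraph :: "'a set set \<Rightarrow> bool" where
  "hypergraph H \<longleftrightarrow> finite (\<Union>H) \<and> {} \<notin> H \<and> (\<forall>x\<in>\<Union>H. {x} \<in> H)"

definition restrict_hg :: "'a set set \<Rightarrow> 'a set \<Rightarrow> 'a set set" where
  "restrict_hg H X = {Z \<in> H. Z \<subseteq> X}"

definition remove_hg :: "'a set set \<Rightarrow> 'a set \<Rightarrow> 'a set set" where
  "remove_hg H X = restrict_hg H (\<Union>H - X)"

definition connected_hg :: "'a set set \<Rightarrow> bool" where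
  "connected_hg H \<longleftrightarrow>
     \<not> (\<exists>X1 X2. X1 \<noteq> {} \<and> X2 \<noteq> {} \<and> X1 \<inter> X2 = {} \<and> X1 \<union> X2 = \<Union>H \<and>
              H = restrict_hg H X1 \<union> restrict_hg H X2)"

definition connected_components :: "'a set set \<Rightarrow> 'a set set \<Rightarrow> bool" where
  "connected_components H P \<longleftrightarrow>
     partition_on (\<Union>H) P \<and> (\<forall>C\<in>P. connected_hg (restrict_hg H C)) \<and>
     H = (\<Union>C\<in>P. restrict_hg H C)"

text \<open>\<open>decomposes H X {H\<^sub>1, \<dots>, H\<^sub>n}\<close> stands for \<open>H, X \<leadsto> H\<^sub>1, \<dots>, H\<^sub>n\<close>.
  The set of components exists and is unique, see \<open>connected_components_ex1\<close> below.\<close>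

definition decomposes :: "'a set set \<Rightarrow> 'a set \<Rightarrow> 'a set set \<Rightarrow> bool" where
  "decomposes H X P \<longleftrightarrow> connected_components (remove_hg H X) P"


section \<open>Constructs\<close>

text \<open>The immediate subtrees form a set. Nothing is lost compared with a multiset, as
  the immediate subtrees of a node in a construct have disjoint, non-empty sets of
  vertices and hence are distinct.\<close>

datatype 'a ctree = Node "'a set" "'a ctree fset"

primrec nodes :: "'a ctree \<Rightarrow> 'a set set" where
  "nodes (Node Y Ts) = insert Y (\<Union> (fset (nodes |`| Ts)))"

abbreviation vertices :: "'a ctree \<Rightarrow> 'a set" where
  "vertices S \<equiv> \<Union> (nodes S)"

inductive construct :: "'a set set \<Rightarrow> 'a ctree \<Rightarrow> bool" where
  one_node: "\<Union>H \<noteq> {} \<Longrightarrow> construct H (Node (\<Union>H) {||})"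
| graft: "\<lbrakk>Y \<noteq> {}; Y \<subset> \<Union>H; decomposes H Y P;
           \<forall>C\<in>P. construct (restrict_hg H C) (T C); fset Ts = T ` P\<rbrakk>
          \<Longrightarrow> construct H (Node Y Ts)"

definition construction :: "'a set set \<Rightarrow> 'a ctree \<Rightarrow> bool" where
  "construction H S \<longleftrightarrow> construct H S \<and> (\<forall>X\<in>nodes S. is_singleton X)"


section \<open>Orders\<close>

text \<open>The total order on the vertices is the one of the type \<open>'a\<close>. The relation below is
  meant for non-empty finite sets only.\<close>

definition set_less :: "'a::linorder set \<Rightarrow> 'a set \<Rightarrow> bool" where
  "set_less Y Z \<longleftrightarrow> Max Y < Min Z"

definition hereditarily_ordered :: "'a::linorder set set \<Rightarrow> bool" where
  "hereditarily_ordered H \<longleftrightarrow>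
     (\<forall>X P. X \<noteq> {} \<and> X \<subseteq> \<Union>H \<and> decomposes H X P \<longrightarrow>
        (\<exists>Hs. distinct Hs \<and> set Hs = P \<and> sorted_wrt set_less Hs))"

text \<open>\<open>at_subtree R S T\<close>: the tree \<open>T\<close> arises from \<open>S\<close> by replacing one subtree \<open>t\<close> of
  \<open>S\<close> by a tree \<open>t'\<close> with \<open>R t t'\<close>.\<close>

inductive at_subtree :: "('a ctree \<Rightarrow> 'a ctree \<Rightarrow> bool) \<Rightarrow> 'a ctree \<Rightarrow> 'a ctree \<Rightarrow> bool"
  for R where
  here: "R t t' \<Longrightarrow> at_subtree R t t'"
| below: "\<lbrakk>t |\<in>| Ts; at_subtree R t t'\<rbrakk>
          \<Longrightarrow> at_subtree R (Node Z Ts) (Node Z (finsert t' (Ts |-| {|t|})))"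

inductive contract_root :: "'a set \<Rightarrow> 'a set \<Rightarrow> 'a ctree \<Rightarrow> 'a ctree \<Rightarrow> bool"
  for X Y where
  "Node Y Us |\<in>| Ts
   \<Longrightarrow> contract_root X Y (Node X Ts) (Node (X \<union> Y) ((Ts |-| {|Node Y Us|}) |\<union>| Us))"

text \<open>\<open>contracts X Y S T\<close> stands for \<open>S \<subset>\<^bsub>X,Y\<^esub> T\<close>.\<close>

definition contracts :: "'a set \<Rightarrow> 'a set \<Rightarrow> 'a ctree \<Rightarrow> 'a ctree \<Rightarrow> bool" where
  "contracts X Y = at_subtree (contract_root X Y)"

definition construct_less :: "'a::linorder set set \<Rightarrow> 'a ctree \<Rightarrow> 'a ctree \<Rightarrow> bool" where
  "construct_less H S S' \<longleftrightarrow> construct H S \<and> construct H S' \<and>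
     (\<exists>U V. set_less V U \<and> (contracts U V S S' \<or> contracts V U S' S))"

text \<open>In the rule below, \<open>Node {x} Ts\<close> is the subtree rooted at \<open>x\<close> and \<open>Node {y} Us\<close> the
  child \<open>y\<close>; then \<open>A\<close> is the set of all trees \<open>S\<^sub>C\<close> (attached to \<open>x\<close> or to \<open>y\<close>), where \<open>C\<close>
  is recovered as \<open>vertices S\<^sub>C\<close>. The set \<open>K\<close> is the component of \<open>\<^bold>G \<setminus> {y}\<close> containing \<open>x\<close>.\<close>

inductive flip_root :: "'a set set \<Rightarrow> 'a \<Rightarrow> 'a \<Rightarrow> 'a ctree \<Rightarrow> 'a ctree \<Rightarrow> bool"
  for H x y where
  "\<lbrakk>Node {y} Us |\<in>| Ts;
    A = (Ts |-| {|Node {y} Us|}) |\<union>| Us;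
    decomposes (restrict_hg H (vertices (Node {x} Ts))) {y} P; K \<in> P; x \<in> K;
    B = ffilter (\<lambda>t. vertices t \<subseteq> K) A\<rbrakk>
   \<Longrightarrow> flip_root H x y (Node {x} Ts) (Node {y} (finsert (Node {x} B) (A |-| B)))"

text \<open>\<open>is_flip H x y S T\<close> is the graph of the flip: \<open>T = Flip\<^sub>S(x,y)\<close>, including that
  \<open>{x}\<close> is the parent of \<open>{y}\<close> in \<open>S\<close>.\<close>

definition is_flip :: "'a set set \<Rightarrow> 'a \<Rightarrow> 'a \<Rightarrow> 'a ctree \<Rightarrow> 'a ctree \<Rightarrow> bool" where
  "is_flip H x y = at_subtree (flip_root H x y)"

definition flip_less :: "'a::linorder set set \<Rightarrow> 'a ctree \<Rightarrow> 'a ctree \<Rightarrow> bool" where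
  "flip_less H S T \<longleftrightarrow> construction H S \<and> construction H T \<and>
     (\<exists>x y. y < x \<and> is_flip H x y S T)"


section \<open>Existence and uniqueness of the connected components\<close>

lemma vertices_restrict_hg:
  assumes "hypergraph H" "X \<subseteq> \<Union>H"
  shows "\<Union>(restrict_hg H X) = X"
  using assms by (fastforce simp: hypergraph_def restrict_hg_def)

lemma hypergraph_restrict_hg:
  assumes "hypergraph H" shows "hypergraph (restrict_hg H X)"
proof -
  have "\<Union>(restrict_hg H X) \<subseteq> \<Union>H" by (auto simp: restrict_hg_def)
  then have "finite (\<Union>(restrict_hg H X))"
    using assms finite_subset unfolding hypergraph_def by blast
  then show ?thesis using assms by (fastforce simp: hypergraph_def restrict_hg_def)
qed

lemma connected_components_exists:
  assumes "hypergraph H"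
  shows "\<exists>P. connected_components H P"
  using assms
proof (induction "card (\<Union>H)" arbitrary: H rule: less_induct)
  case less
  have fin: "finite (\<Union>H)" using less.prems by (simp add: hypergraph_def)
  show ?case
  proof (cases "connected_hg H")
    case True
    have "restrict_hg H (\<Union>H) = H" by (auto simp: restrict_hg_def)
    moreover have "H = {} \<or> \<Union>H \<noteq> {}"
      using less.prems by (auto simp: hypergraph_def)
    ultimately have "connected_components H (if H = {} then {} else {\<Union>H})"
      using True by (auto simp: connected_components_def partition_on_def)
    then show ?thesis by blast
  next
    case False
    then obtain X Y where XY: "X \<noteq> {}" "Y \<noteq> {}" "X \<inter> Y = {}" "X \<union> Y = \<Union>H"
      "H = restrict_hg H X \<union> restrict_hg H Y"
      by (auto simp: connected_hg_def)
    have v: "\<Union>(restrict_hg H X) = X" "\<Union>(restrict_hg H Y) = Y"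
      using vertices_restrict_hg[OF less.prems] XY(4) by blast+
    have "X \<subset> \<Union>H" "Y \<subset> \<Union>H"
      unfolding XY(4)[symmetric] using XY(1-3) by blast+
    then have "card X < card (\<Union>H)" "card Y < card (\<Union>H)"
      using psubset_card_mono[OF fin] by blast+
    then obtain P Q where P: "connected_components (restrict_hg H X) P"
      and Q: "connected_components (restrict_hg H Y) Q"
      using less.hyps[of "restrict_hg H X"] less.hyps[of "restrict_hg H Y"] v
        hypergraph_restrict_hg[OF less.prems] by metis
    have pP: "partition_on X P" and pQ: "partition_on Y Q"
      using P Q v by (simp_all add: connected_components_def)
    have sP: "restrict_hg (restrict_hg H X) C = restrict_hg H C" if "C \<in> P" for C
      using that partition_onD1[OF pP] by (auto simp: restrict_hg_def)
    have sQ: "restrict_hg (restrict_hg H Y) C = restrict_hg H C" if "C \<in> Q" for C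
      using that partition_onD1[OF pQ] by (auto simp: restrict_hg_def)
    have "partition_on (\<Union>H) (P \<union> Q)"
    proof (rule partition_onI)
      show "\<Union>(P \<union> Q) = \<Union>H"
        using partition_onD1[OF pP] partition_onD1[OF pQ] XY(4) by blast
      show "disjnt C D" if CD: "C \<in> P \<union> Q" "D \<in> P \<union> Q" "C \<noteq> D" for C D
      proof -
        have cX: "E \<subseteq> X" if "E \<in> P" for E using partition_onD1[OF pP] that by blast
        have cY: "E \<subseteq> Y" if "E \<in> Q" for E using partition_onD1[OF pQ] that by blast
        consider "C \<in> P" "D \<in> P" | "C \<in> Q" "D \<in> Q" | "C \<in> P" "D \<in> Q" | "C \<in> Q" "D \<in> P"
          using CD(1,2) by auto
        then show ?thesis
        proof cases
          case 1
          then show ?thesis using partition_onD2[OF pP] CD(3) by (auto simp: pairwise_def)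
        next
          case 2
          then show ?thesis using partition_onD2[OF pQ] CD(3) by (auto simp: pairwise_def)
        next
          case 3
          then show ?thesis using cX[of C] cY[of D] XY(3) by (auto simp: disjnt_def)
        next
          case 4
          then show ?thesis using cX[of D] cY[of C] XY(3) by (auto simp: disjnt_def)
        qed
      qed
      show "{} \<notin> P \<union> Q"
        using partition_onD3[OF pP] partition_onD3[OF pQ] by blast
    qed
    moreover have "\<forall>C\<in>P \<union> Q. connected_hg (restrict_hg H C)"
      using P Q sP sQ by (auto simp: connected_components_def)
    moreover have "restrict_hg H X = (\<Union>C\<in>P. restrict_hg H C)"
      using P sP by (simp add: connected_components_def)
    moreover have "restrict_hg H Y = (\<Union>C\<in>Q. restrict_hg H C)"
      using Q sQ by (simp add: connected_components_def)
    ultimately have "connected_components H (P \<union> Q)"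
      unfolding connected_components_def UN_Un using XY(5) by metis
    then show ?thesis by blast
  qed
qed

lemma component_subset:
  assumes H: "hypergraph H" and P: "connected_components H P"
    and Q: "connected_components H Q" and "C \<in> P" "D \<in> Q" "C \<inter> D \<noteq> {}"
  shows "C \<subseteq> D"
proof (rule ccontr)
  assume "\<not> C \<subseteq> D"
  have pP: "partition_on (\<Union>H) P" and pQ: "partition_on (\<Union>H) Q"
    using P Q by (simp_all add: connected_components_def)
  have "C \<subseteq> \<Union>H" using partition_onD1[OF pP] \<open>C \<in> P\<close> by blast
  then have v: "\<Union>(restrict_hg H C) = C" by (rule vertices_restrict_hg[OF H])
  have split: "Z \<subseteq> D \<or> Z \<inter> D = {}" if "Z \<in> H" for Z
  proof -
    have "Z \<in> (\<Union>C\<in>Q. restrict_hg H C)"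
      using Q that by (simp add: connected_components_def)
    then obtain E where E: "E \<in> Q" "Z \<subseteq> E" by (auto simp: restrict_hg_def)
    have "E = D \<or> disjnt E D"
      using partition_onD2[OF pQ] E(1) \<open>D \<in> Q\<close> by (auto simp: pairwise_def)
    then show ?thesis using E(2) by (auto simp: disjnt_def)
  qed
  have "restrict_hg H C =
      restrict_hg (restrict_hg H C) (C \<inter> D) \<union> restrict_hg (restrict_hg H C) (C - D)"
  proof
    show "restrict_hg H C \<subseteq>
        restrict_hg (restrict_hg H C) (C \<inter> D) \<union> restrict_hg (restrict_hg H C) (C - D)"
    proof
      fix Z assume "Z \<in> restrict_hg H C"
      then have "Z \<in> H" "Z \<subseteq> C" by (simp_all add: restrict_hg_def)
      moreover have "Z \<subseteq> C \<inter> D \<or> Z \<subseteq> C - D"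
        using split[OF \<open>Z \<in> H\<close>] \<open>Z \<subseteq> C\<close> by blast
      ultimately show "Z \<in> restrict_hg (restrict_hg H C) (C \<inter> D) \<union>
          restrict_hg (restrict_hg H C) (C - D)"
        by (auto simp: restrict_hg_def)
    qed
  qed (auto simp: restrict_hg_def)
  moreover have "C - D \<noteq> {}" "C \<inter> D \<inter> (C - D) = {}" "C \<inter> D \<union> (C - D) = C"
    using \<open>\<not> C \<subseteq> D\<close> by auto
  ultimately have "\<not> connected_hg (restrict_hg H C)"
    unfolding connected_hg_def v using \<open>C \<inter> D \<noteq> {}\<close> by metis
  then show False using P \<open>C \<in> P\<close> by (auto simp: connected_components_def)
qed

lemma connected_components_subset:
  assumes "hypergraph H" "connected_components H P" "connected_components H Q"
  shows "P \<subseteq> Q"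
proof
  fix C assume C: "C \<in> P"
  have pP: "partition_on (\<Union>H) P" and pQ: "partition_on (\<Union>H) Q"
    using assms by (simp_all add: connected_components_def)
  obtain a where a: "a \<in> C" using partition_onD3[OF pP] C by fastforce
  then obtain D where D: "D \<in> Q" "a \<in> D"
    using partition_onD1[OF pP] partition_onD1[OF pQ] C by blast
  have "C = D"
    using component_subset[OF assms C D(1)] component_subset[OF assms(1,3,2) D(1) C] a D(2)
    by blast
  then show "C \<in> Q" using D by simp
qed

lemma connected_components_ex1:
  assumes "hypergraph H" shows "\<exists>!P. connected_components H P"
  using connected_components_exists[OF assms] connected_components_subset[OF assms]
  by (meson subset_antisym)

end

theory Submission
  imports Defs
begin

text \<open>To a construct \<open>S\<close> assign the construction \<open>decr H S\<close> obtained by replacing every node \<open>Y\<close> with the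
  elimination, one vertex at a time, of the elements of \<open>Y\<close> in decreasing order. It is \<open>S\<close> itself
  if \<open>S\<close> is a construction. A fusion of \<open>U\<close> and \<open>V\<close> with \<open>U > V\<close> does not change it, because the
  decreasing enumeration of \<open>U \<union> V\<close> is that of \<open>U\<close> followed by that of \<open>V\<close>. A split interchanges
  these two blocks; exchanging two consecutive vertices \<open>u > v\<close> of an elimination order is a flip if
  both lie in the same component and has no effect otherwise. Hence a path of fusions and splits
  yields a path of flips, which is not empty because the last step of a path to a construction is
  a split. Conversely, a flip is a fusion followed by a split.\<close>

section \<open>Components and constructs\<close>

text \<open>The hypergraph \<open>H\<close> stays fixed and only the vertex set varies, so that
  components of nested restrictions can be compared directly. For a hypergraph the description is
  justified by \<open>connected_components_ex1\<close>.\<close>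

definition comps :: "'a set set \<Rightarrow> 'a set \<Rightarrow> 'a set set" where
  "comps H W = (THE P. connected_components (restrict_hg H W) P)"

definition conn :: "'a set set \<Rightarrow> 'a set \<Rightarrow> bool" where
  "conn H K \<longleftrightarrow> K \<noteq> {} \<and> K \<subseteq> \<Union>H \<and> connected_hg (restrict_hg H K)"

text \<open>A construct of the restriction of \<open>H\<close> to the vertices of the tree itself.
  Subtrees at every depth thus satisfy the same predicate with the same \<open>H\<close>.\<close>

definition construct_in :: "'a set set \<Rightarrow> 'a ctree \<Rightarrow> bool" where
  "construct_in H t \<longleftrightarrow> vertices t \<subseteq> \<Union>H \<and> construct (restrict_hg H (vertices t)) t"

section \<open>Components as maximal connected subsets\<close>

lemma vertices_Node: "vertices (Node Y Ts) = Y \<union> (\<Union>t\<in>fset Ts. vertices t)"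
  by auto

declare nodes.simps [simp del]

lemma restrict_restrict_hg: "D \<subseteq> C \<Longrightarrow> restrict_hg (restrict_hg H C) D = restrict_hg H D"
  by (auto simp: restrict_hg_def)

lemma restrict_hg_vertices [simp]: "restrict_hg H (\<Union>H) = H"
  by (auto simp: restrict_hg_def)

text \<open>Otherwise \<open>K\<close> meets a block \<open>C\<close> without lying in it. Since
  each hyperedge inside \<open>W\<close> lies in one block, \<open>K \<inter> C\<close> and
  \<open>K - C\<close> would then separate \<open>K\<close>.\<close>

lemma conn_within_part:
  assumes H: "hypergraph H" and P: "partition_on W P"
    and edge: "\<And>Z. Z \<in> H \<Longrightarrow> Z \<subseteq> W \<Longrightarrow> \<exists>C\<in>P. Z \<subseteq> C"
    and K: "conn H K" "K \<subseteq> W"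
  shows "\<exists>C\<in>P. K \<subseteq> C"
proof (rule ccontr)
  assume no: "\<not> ?thesis"
  from K(1) obtain a where a: "a \<in> K" by (auto simp: conn_def)
  with K(2) partition_onD1[OF P] obtain C where C: "C \<in> P" "a \<in> C" by blast
  have K': "K \<subseteq> \<Union>H" using K(1) by (simp add: conn_def)
  have v: "\<Union>(restrict_hg H K) = K" using vertices_restrict_hg[OF H K'] .
  have "K - C \<noteq> {}" using no C by blast
  moreover have "K \<inter> C \<noteq> {}" using a C by blast
  moreover have "restrict_hg H K =
      restrict_hg (restrict_hg H K) (K \<inter> C) \<union> restrict_hg (restrict_hg H K) (K - C)"
  proof -
    have "Z \<subseteq> K \<inter> C \<or> Z \<subseteq> K - C" if Z: "Z \<in> H" "Z \<subseteq> K" for Z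
    proof -
      obtain D where D: "D \<in> P" "Z \<subseteq> D" using edge Z K(2) by blast
      show ?thesis
      proof (cases "D = C")
        case False
        then have "D \<inter> C = {}"
          using partition_onD2[OF P] D(1) C(1) by (auto simp: pairwise_def disjnt_def)
        then show ?thesis using D Z by blast
      qed (use D Z in blast)
    qed
    then show ?thesis by (auto simp: restrict_hg_def)
  qed
  moreover have "(K \<inter> C) \<inter> (K - C) = {}" "(K \<inter> C) \<union> (K - C) = K" by auto
  ultimately have "\<not> connected_hg (restrict_hg H K)"
    unfolding connected_hg_def v by metis
  then show False using K(1) by (simp add: conn_def)
qed

context
  fixes H :: "'a set set"
  assumes H: "hypergraph H"
begin

lemma comps_eqI:
  assumes "connected_components (restrict_hg H W) P"
  shows "comps H W = P"
  unfolding comps_def using connected_components_ex1[OF hypergraph_restrict_hg[OF H]] assms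
  by (metis the1_equality)

lemma connected_components_comps: "connected_components (restrict_hg H W) (comps H W)"
  unfolding comps_def
  by (rule theI') (rule connected_components_ex1[OF hypergraph_restrict_hg[OF H]])

lemma comps_partition: "W \<subseteq> \<Union>H \<Longrightarrow> partition_on W (comps H W)"
  using connected_components_comps[of W] vertices_restrict_hg[OF H, of W]
  by (simp add: connected_components_def)

lemma comps_subset: "W \<subseteq> \<Union>H \<Longrightarrow> C \<in> comps H W \<Longrightarrow> C \<subseteq> W"
  using partition_onD1[OF comps_partition[of W]] by blast

lemma comps_nonempty: "W \<subseteq> \<Union>H \<Longrightarrow> C \<in> comps H W \<Longrightarrow> C \<noteq> {}"
  using partition_onD3[OF comps_partition[of W]] by blast

lemma comps_eq_or_disjoint:
  "W \<subseteq> \<Union>H \<Longrightarrow> C \<in> comps H W \<Longrightarrow> D \<in> comps H W \<Longrightarrow> C = D \<or> C \<inter> D = {}"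
  using partition_onD2[OF comps_partition[of W]] by (auto simp: pairwise_def disjnt_def)

lemma comps_cover: "W \<subseteq> \<Union>H \<Longrightarrow> a \<in> W \<Longrightarrow> \<exists>C\<in>comps H W. a \<in> C"
  using partition_onD1[OF comps_partition[of W]] by blast

lemma comps_empty: "comps H {} = {}"
  using comps_partition[of "{}"] by (auto simp: partition_on_def)

lemma comps_conn:
  assumes "W \<subseteq> \<Union>H" "C \<in> comps H W" shows "conn H C"
proof -
  have "connected_hg (restrict_hg (restrict_hg H W) C)"
    using connected_components_comps[of W] assms(2) by (simp add: connected_components_def)
  then show ?thesis
    using comps_subset[OF assms] comps_nonempty[OF assms] assms(1)
    by (auto simp: conn_def restrict_restrict_hg)
qed

lemma conn_within_comps:
  assumes "conn H K" "K \<subseteq> W" "W \<subseteq> \<Union>H"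
  shows "\<exists>C\<in>comps H W. K \<subseteq> C"
proof (rule conn_within_part[OF H comps_partition[OF assms(3)] _ assms(1,2)])
  fix Z assume "Z \<in> H" "Z \<subseteq> W"
  then have "Z \<in> restrict_hg H W" by (simp add: restrict_hg_def)
  also have "restrict_hg H W = (\<Union>C\<in>comps H W. restrict_hg (restrict_hg H W) C)"
    using connected_components_comps[of W] by (simp add: connected_components_def)
  finally show "\<exists>C\<in>comps H W. Z \<subseteq> C" by (auto simp: restrict_hg_def)
qed

text \<open>A connected subset of \<open>W\<close> lies in a single component, so one containing
  \<open>C\<close> cannot exceed it. This description mentions no partition and therefore allows
  components of different sets to be compared.\<close>

lemma comps_maximal:
  assumes W: "W \<subseteq> \<Union>H"
  shows "C \<in> comps H W \<longleftrightarrow> conn H C \<and> C \<subseteq> W \<and> (\<forall>D. conn H D \<and> C \<subseteq> D \<and> D \<subseteq> W \<longrightarrow> D = C)"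
proof
  assume C: "C \<in> comps H W"
  have "D = C" if D: "conn H D" "C \<subseteq> D" "D \<subseteq> W" for D
  proof -
    obtain E where "E \<in> comps H W" "D \<subseteq> E" using conn_within_comps[OF D(1,3) W] by blast
    then show ?thesis
      using comps_eq_or_disjoint[OF W C, of E] comps_nonempty[OF W C] D(2) by blast
  qed
  then show "conn H C \<and> C \<subseteq> W \<and> (\<forall>D. conn H D \<and> C \<subseteq> D \<and> D \<subseteq> W \<longrightarrow> D = C)"
    using comps_conn[OF W C] comps_subset[OF W C] by simp
next
  assume *: "conn H C \<and> C \<subseteq> W \<and> (\<forall>D. conn H D \<and> C \<subseteq> D \<and> D \<subseteq> W \<longrightarrow> D = C)"
  then have "conn H C" "C \<subseteq> W" by simp_all
  from conn_within_comps[OF this W] obtain D where D: "D \<in> comps H W" "C \<subseteq> D" by blast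
  have "D = C" using * comps_conn[OF W D(1)] comps_subset[OF W D(1)] D(2) by simp
  then show "C \<in> comps H W" using D(1) by simp
qed

text \<open>Every connected subset of \<open>W\<close> either lies in \<open>C\<close> or misses it.
  Maximality in \<open>W - Y\<close> can therefore be tested in \<open>W\<close> for sets that miss
  \<open>C\<close>, and in \<open>C - Y\<close> for the others.\<close>

lemma comps_Diff:
  assumes W: "W \<subseteq> \<Union>H" and C: "C \<in> comps H W" and Y: "Y \<subseteq> C"
  shows "comps H (W - Y) = (comps H W - {C}) \<union> comps H (C - Y)"
proof -
  have W': "W - Y \<subseteq> \<Union>H" and C': "C - Y \<subseteq> \<Union>H"
    using W comps_subset[OF W C] by auto
  have sub: "C \<subseteq> W" using comps_subset[OF W C] .
  have D: "D \<subseteq> C \<or> D \<inter> C = {}" if "conn H D" "D \<subseteq> W" for D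
    using conn_within_comps[OF that W] comps_eq_or_disjoint[OF W _ C] by blast
  have "D \<in> comps H (W - Y) \<longleftrightarrow> D \<in> comps H W \<and> D \<noteq> C \<or> D \<in> comps H (C - Y)" for D
  proof (cases "D \<inter> C = {}")
    case True
    have "D \<in> comps H (W - Y) \<longleftrightarrow> D \<in> comps H W"
      unfolding comps_maximal[OF W] comps_maximal[OF W']
    proof (intro iffI conjI; elim conjE)
      assume a: "conn H D" "D \<subseteq> W - Y" and
        m: "\<forall>E. conn H E \<and> D \<subseteq> E \<and> E \<subseteq> W - Y \<longrightarrow> E = D"
      have "E = D" if "conn H E" "D \<subseteq> E" "E \<subseteq> W" for E
      proof -
        have "E \<inter> C = {}" using D[OF that(1,3)] True a(1) that(2) by (auto simp: conn_def)
        then show ?thesis using m that Y by blast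
      qed
      then show "\<forall>E. conn H E \<and> D \<subseteq> E \<and> E \<subseteq> W \<longrightarrow> E = D" by blast
    qed (use True Y in blast)+
    moreover have "D \<noteq> C" "D \<notin> comps H (C - Y)" if "D \<noteq> {}"
      using True that comps_subset[OF C'] by blast+
    ultimately show ?thesis using comps_nonempty[OF C', of D] comps_nonempty[OF W, of D] by blast
  next
    case False
    have "D \<notin> comps H W \<or> D = C" using comps_eq_or_disjoint[OF W _ C] False by blast
    moreover have "D \<in> comps H (W - Y) \<longleftrightarrow> D \<in> comps H (C - Y)"
      unfolding comps_maximal[OF C'] comps_maximal[OF W']
    proof (intro iffI conjI; elim conjE)
      assume a: "conn H D" "D \<subseteq> W - Y"
      then show "D \<subseteq> C - Y" using D[OF a(1)] False by blast
    next
      assume a: "D \<subseteq> C - Y" and m: "\<forall>E. conn H E \<and> D \<subseteq> E \<and> E \<subseteq> C - Y \<longrightarrow> E = D"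
      have "E = D" if e: "conn H E" "D \<subseteq> E" "E \<subseteq> W - Y" for E
      proof -
        have "E \<subseteq> C" using D[OF e(1)] e(2,3) False by blast
        then show ?thesis using m e by blast
      qed
      then show "\<forall>E. conn H E \<and> D \<subseteq> E \<and> E \<subseteq> W - Y \<longrightarrow> E = D" by blast
    qed (use sub in blast)+
    ultimately show ?thesis by blast
  qed
  then show ?thesis by blast
qed

lemma decomposes_iff:
  assumes "G \<subseteq> \<Union>H"
  shows "decomposes (restrict_hg H G) Y P \<longleftrightarrow> P = comps H (G - Y)"
proof -
  have "remove_hg (restrict_hg H G) Y = restrict_hg H (G - Y)"
    unfolding remove_hg_def vertices_restrict_hg[OF H assms] by (rule restrict_restrict_hg) auto
  then show ?thesis
    unfolding decomposes_def using comps_eqI connected_components_comps by metis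
qed

end

section \<open>Constructs described through vertex sets\<close>

lemma construct_vertices: "construct H t \<Longrightarrow> hypergraph H \<Longrightarrow> vertices t = \<Union>H"
proof (induction rule: construct.induct)
  case (one_node H)
  then show ?case by (simp add: vertices_Node)
next
  case (graft Y H P T Ts)
  have G: "\<Union>H \<subseteq> \<Union>H" by simp
  have P: "P = comps H (\<Union>H - Y)"
    using graft(3) decomposes_iff[OF graft.prems G] by simp
  have p: "partition_on (\<Union>H - Y) P"
    unfolding P by (rule comps_partition[OF graft.prems]) auto
  have "vertices (T C) = C" if "C \<in> P" for C
  proof -
    have "C \<subseteq> \<Union>H" using that partition_onD1[OF p] by blast
    then have "\<Union>(restrict_hg H C) = C" by (rule vertices_restrict_hg[OF graft.prems])
    moreover have "vertices (T C) = \<Union>(restrict_hg H C)"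
      using graft.IH that hypergraph_restrict_hg[OF graft.prems] by blast
    ultimately show ?thesis by (rule trans[rotated])
  qed
  then have "(\<Union>t\<in>fset Ts. vertices t) = \<Union>P" using \<open>fset Ts = T ` P\<close> by simp
  then have "vertices (Node Y Ts) = Y \<union> (\<Union>H - Y)"
    unfolding vertices_Node partition_onD1[OF p] by (rule arg_cong)
  also have "\<dots> = \<Union>H" using graft(2) by blast
  finally show ?case .
qed

context
  fixes H :: "'a set set"
  assumes H: "hypergraph H"
begin

lemma construct_iff: "construct H t \<longleftrightarrow> construct_in H t \<and> vertices t = \<Union>H"
proof (cases "vertices t = \<Union>H")
  case True
  then show ?thesis unfolding construct_in_def True by simp
qed (use construct_vertices[OF _ H] in blast)

text \<open>The choice function of rule \<open>graft\<close> is replaced by the condition that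
  \<open>vertices\<close> matches the children with the components. The one-node tree is included,
  as the empty set has no components. Later arguments about constructs rest on this recursive
  form.\<close>

lemma construct_in_Node:
  "construct_in H (Node Y Ts) \<longleftrightarrow> Y \<noteq> {} \<and> Y \<subseteq> \<Union>H \<and>
     bij_betw vertices (fset Ts) (comps H (vertices (Node Y Ts) - Y)) \<and>
     (\<forall>t\<in>fset Ts. construct_in H t)" (is "?L \<longleftrightarrow> ?R")
proof
  assume L: ?L
  let ?G = "vertices (Node Y Ts)"
  have G: "?G \<subseteq> \<Union>H" and c: "construct (restrict_hg H ?G) (Node Y Ts)"
    using L by (auto simp: construct_in_def)
  have Y: "Y \<subseteq> ?G" by (auto simp: vertices_Node)
  note hG = hypergraph_restrict_hg[OF H, of ?G]
  note vG = vertices_restrict_hg[OF H G]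
  have W: "?G - Y \<subseteq> \<Union>H" using G by auto
  from c have "Y \<noteq> {} \<and> (\<exists>T. (\<forall>C\<in>comps H (?G - Y). construct (restrict_hg H C) (T C)) \<and>
    fset Ts = T ` comps H (?G - Y))"
  proof cases
    case one_node
    then show ?thesis using vG comps_empty[OF H] by auto
  next
    case (graft P T)
    have P: "P = comps H (?G - Y)" using graft(3) decomposes_iff[OF H G] by simp
    have "restrict_hg (restrict_hg H ?G) C = restrict_hg H C" if "C \<in> P" for C
      using comps_subset[OF H W, of C] that unfolding P by (intro restrict_restrict_hg) auto
    then show ?thesis using graft P by auto
  qed
  then obtain T where Y0: "Y \<noteq> {}"
    and T: "\<forall>C\<in>comps H (?G - Y). construct (restrict_hg H C) (T C)"
    and Ts: "fset Ts = T ` comps H (?G - Y)" by blast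
  have CH: "C \<subseteq> \<Union>H" if "C \<in> comps H (?G - Y)" for C
    using comps_subset[OF H W that] W by blast
  have v: "vertices (T C) = C" if "C \<in> comps H (?G - Y)" for C
    using construct_vertices[OF _ hypergraph_restrict_hg[OF H]] T that
      vertices_restrict_hg[OF H CH[OF that]] by metis
  have "bij_betw vertices (fset Ts) (comps H (?G - Y))"
    unfolding Ts by (rule bij_betwI[where g = T]) (use v in auto)
  moreover have "\<forall>t\<in>fset Ts. construct_in H t"
    using Ts T v CH by (auto simp: construct_in_def)
  ultimately show ?R using Y0 Y G by blast
next
  assume R: ?R
  let ?G = "vertices (Node Y Ts)"
  have G: "?G \<subseteq> \<Union>H" using R unfolding construct_in_def vertices_Node by blast
  have Y: "Y \<subseteq> ?G" by (auto simp: vertices_Node)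
  note vG = vertices_restrict_hg[OF H G]
  have W: "?G - Y \<subseteq> \<Union>H" using G by auto
  have b: "bij_betw vertices (fset Ts) (comps H (?G - Y))" using R by blast
  have "construct (restrict_hg H ?G) (Node Y Ts)"
  proof (cases "Y = ?G")
    case True
    then have "?G - Y = {}" by blast
    then have "vertices ` fset Ts = {}"
      using b comps_empty[OF H] unfolding bij_betw_def by metis
    then have Ts: "Ts = {||}" by (simp flip: fset_inject)
    have Y: "Y = \<Union>(restrict_hg H ?G)" using True vG by blast
    have "construct (restrict_hg H ?G) (Node (\<Union>(restrict_hg H ?G)) {||})"
      by (rule construct.one_node) (use R Y in blast)
    then show ?thesis using Ts Y by metis
  next
    case False
    \<comment> \<open>The inverse of \<open>vertices\<close> on the children serves as the choice
      function that rule \<open>graft\<close> asks for.\<close>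
    define T where "T = inv_into (fset Ts) vertices"
    have T: "T C \<in> fset Ts \<and> vertices (T C) = C" if "C \<in> comps H (?G - Y)" for C
      unfolding T_def using bij_betw_inv_into_right[OF b that] bij_betw_apply[OF bij_betw_inv_into[OF b] that]
      by blast
    have TT: "T (vertices t) = t" if "t \<in> fset Ts" for t
      unfolding T_def using bij_betw_inv_into_left[OF b that] .
    show ?thesis
    proof (rule construct.graft)
      show "Y \<subset> \<Union>(restrict_hg H ?G)" using vG Y False by auto
      show "decomposes (restrict_hg H ?G) Y (comps H (?G - Y))"
        using decomposes_iff[OF H G] by simp
      show "\<forall>C\<in>comps H (?G - Y). construct (restrict_hg (restrict_hg H ?G) C) (T C)"
      proof
        fix C assume C: "C \<in> comps H (?G - Y)"
        have "C \<subseteq> ?G" using comps_subset[OF H W C] by blast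
        then show "construct (restrict_hg (restrict_hg H ?G) C) (T C)"
          using T[OF C] R by (metis construct_in_def restrict_restrict_hg)
      qed
      have "comps H (?G - Y) = vertices ` fset Ts" using b by (simp add: bij_betw_def)
      then show "fset Ts = T ` comps H (?G - Y)" using TT by (auto simp: image_image)
    qed (use R in blast)
  qed
  then show ?L using G by (simp add: construct_in_def)
qed

end

lemma nodes_Node: "nodes (Node Y Ts) = insert Y (\<Union>t\<in>fset Ts. nodes t)"
  by (simp add: nodes.simps)

section \<open>Elimination orders and flips\<close>

definition construction_on :: "'a set set \<Rightarrow> 'a set \<Rightarrow> 'a ctree \<Rightarrow> bool" where
  "construction_on H G t \<longleftrightarrow>
     construct_in H t \<and> vertices t = G \<and> (\<forall>X\<in>nodes t. is_singleton X)"

text \<open>\<open>elim H f zs G\<close> removes the vertices \<open>zs\<close> from the connected set \<open>G\<close> in the given order, each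
  becoming the root for the component in which it lies; a component \<open>C\<close> of what finally remains is
  filled with the tree \<open>f C\<close>.\<close>

primrec elim :: "'a set set \<Rightarrow> ('a set \<Rightarrow> 'a ctree) \<Rightarrow> 'a list \<Rightarrow> 'a set \<Rightarrow> 'a ctree" where
  "elim H f [] G = f G"
| "elim H f (z # zs) G =
     (if z \<in> G then Node {z} (Abs_fset (elim H f zs ` comps H (G - {z}))) else elim H f zs G)"

text \<open>The second block is eliminated inside each component left by the first, so it acts as
  the filling function of the first. In this form a contracted edge becomes a concatenation of
  lists.\<close>

lemma elim_append: "elim H f (xs @ ys) G = elim H (elim H f ys) xs G"
  by (induction xs arbitrary: G) simp_all

section \<open>Trees built from elimination orders\<close>

context
  fixes H :: "'a set set"
  assumes H: "hypergraph H"
begin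

lemma comps_finite: "G \<subseteq> \<Union>H \<Longrightarrow> finite (comps H G)"
  using finite_elements[OF _ comps_partition[OF H]] H
  by (meson finite_subset hypergraph_def)

lemma fset_comps_image: "G \<subseteq> \<Union>H \<Longrightarrow> fset (Abs_fset (f ` comps H G)) = f ` comps H G"
  by (rule Abs_fset_inverse) (simp add: comps_finite)

lemma comps_of_conn: "conn H G \<Longrightarrow> comps H G = {G}"
proof -
  assume G: "conn H G"
  then have s: "G \<subseteq> \<Union>H" by (simp add: conn_def)
  have "G \<in> comps H G" unfolding comps_maximal[OF H s] using G by auto
  moreover have "C = G" if "C \<in> comps H G" for C
    using comps_eq_or_disjoint[OF H s that \<open>G \<in> comps H G\<close>] comps_subset[OF H s that]
      comps_nonempty[OF H s that] by blast
  ultimately show ?thesis by auto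
qed

text \<open>A connected \<open>E\<close> with \<open>D \<subseteq> E \<subseteq> W - Y\<close> lies
  in one component of \<open>W\<close>, which must be \<open>C\<close> because \<open>D\<close> is
  non-empty; hence maximality in \<open>C - Y\<close> suffices. Together with
  \<open>comps_comps_ex\<close> this says that decomposing in two stages gives the same components
  as decomposing at once.\<close>

lemma comps_comps:
  assumes W: "W \<subseteq> \<Union>H" and C: "C \<in> comps H W" and D: "D \<in> comps H (C - Y)"
  shows "D \<in> comps H (W - Y)"
proof -
  have C': "C - Y \<subseteq> \<Union>H" and W': "W - Y \<subseteq> \<Union>H" using comps_subset[OF H W C] W by auto
  have D': "conn H D" "D \<subseteq> C - Y" "\<And>E. conn H E \<Longrightarrow> D \<subseteq> E \<Longrightarrow> E \<subseteq> C - Y \<Longrightarrow> E = D"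
    using D unfolding comps_maximal[OF H C'] by blast+
  have "E = D" if E: "conn H E" "D \<subseteq> E" "E \<subseteq> W - Y" for E
  proof -
    have "E \<subseteq> W" using E(3) by blast
    obtain C2 where C2: "C2 \<in> comps H W" "E \<subseteq> C2"
      using conn_within_comps[OF H E(1) \<open>E \<subseteq> W\<close> W] by blast
    have "D \<noteq> {}" using D'(1) by (simp add: conn_def)
    then have "C2 = C" using comps_eq_or_disjoint[OF H W C2(1) C] D'(2) E(2) C2(2) by blast
    then show ?thesis using D'(3) E C2(2) by blast
  qed
  moreover have "D \<subseteq> W - Y" using D'(2) comps_subset[OF H W C] by blast
  ultimately show ?thesis unfolding comps_maximal[OF H W'] using D'(1) by blast
qed

lemma comps_comps_ex:
  assumes W: "W \<subseteq> \<Union>H" and D: "D \<in> comps H (W - Y)"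
  obtains C where "C \<in> comps H W" "D \<in> comps H (C - Y)"
proof -
  have W': "W - Y \<subseteq> \<Union>H" using W by auto
  have "conn H D" "D \<subseteq> W" using comps_conn[OF H W' D] comps_subset[OF H W' D] by auto
  then obtain C where C: "C \<in> comps H W" "D \<subseteq> C" using conn_within_comps[OF H _ _ W] by blast
  obtain a where a: "a \<in> D" using comps_nonempty[OF H W' D] by blast
  have aC: "a \<in> C - Y" using a C(2) comps_subset[OF H W' D] by blast
  have C': "C - Y \<subseteq> \<Union>H" using comps_subset[OF H W C(1)] W by auto
  obtain E where E: "E \<in> comps H (C - Y)" "a \<in> E" using comps_cover[OF H C' aC] by blast
  have "E = D" using comps_eq_or_disjoint[OF H W' comps_comps[OF W C(1) E(1)] D] E(2) a by blast
  then show thesis using that C(1) E(1) by blast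
qed

text \<open>On a connected set, \<open>elim\<close> consults \<open>f\<close> only at the components
  left after all of \<open>zs\<close> is removed. Connectedness enters for the empty list, where
  \<open>comps H G\<close> has to be \<open>{G}\<close>.\<close>

lemma elim_cong:
  assumes "conn H G" "\<And>C. C \<in> comps H (G - set zs) \<Longrightarrow> f C = g C"
  shows "elim H f zs G = elim H g zs G"
  using assms
proof (induction zs arbitrary: G)
  case Nil
  then show ?case using comps_of_conn by auto
next
  case (Cons z zs)
  have G: "G - {z} \<subseteq> \<Union>H" using Cons.prems(1) by (auto simp: conn_def)
  have e: "G - set (z # zs) = (G - {z}) - set zs" by auto
  show ?case
  proof (cases "z \<in> G")
    case True
    have "elim H f zs C = elim H g zs C" if "C \<in> comps H (G - {z})" for C
      using Cons.IH[OF comps_conn[OF H G that]] comps_comps[OF G that, of _ "set zs"]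
        Cons.prems(2) unfolding e by blast
    then have "elim H f zs ` comps H (G - {z}) = elim H g zs ` comps H (G - {z})" by auto
    then show ?thesis using True by (simp only: elim.simps if_True)
  next
    case False
    then have "G - set (z # zs) = G - set zs" by auto
    then show ?thesis using Cons False by simp
  qed
qed

lemma construction_on_Node:
  assumes z: "z \<in> G" and G: "G \<subseteq> \<Union>H"
    and g: "\<And>C. C \<in> comps H (G - {z}) \<Longrightarrow> construction_on H C (g C)"
  shows "construction_on H G (Node {z} (Abs_fset (g ` comps H (G - {z}))))"
proof -
  have W: "G - {z} \<subseteq> \<Union>H" using G by auto
  note fs = fset_comps_image[OF W]
  have v: "vertices (g C) = C" "construct_in H (g C)" "\<forall>X\<in>nodes (g C). is_singleton X"
    if "C \<in> comps H (G - {z})" for C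
    using g[OF that] by (auto simp: construction_on_def)
  let ?t = "Node {z} (Abs_fset (g ` comps H (G - {z})))"
  have "(\<Union>t\<in>g ` comps H (G - {z}). vertices t) = \<Union>(comps H (G - {z}))"
    using v(1) by simp
  then have vt: "vertices ?t = G"
    unfolding vertices_Node fs using partition_onD1[OF comps_partition[OF H W]] z by auto
  have "bij_betw vertices (g ` comps H (G - {z})) (comps H (G - {z}))"
    by (rule bij_betwI[where g = g]) (use v(1) in auto)
  then have "construct_in H ?t"
    unfolding construct_in_Node[OF H] vt fs using z G v(2) by auto
  moreover have "\<forall>X\<in>nodes ?t. is_singleton X"
    unfolding nodes_Node fs using v(3) by auto
  ultimately show ?thesis using vt by (simp add: construction_on_def)
qed

lemma construction_on_elim:
  assumes "conn H G" "\<And>C. C \<in> comps H (G - set zs) \<Longrightarrow> construction_on H C (f C)"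
  shows "construction_on H G (elim H f zs G)"
  using assms
proof (induction zs arbitrary: G)
  case Nil
  then show ?case using comps_of_conn by auto
next
  case (Cons z zs)
  have G: "G - {z} \<subseteq> \<Union>H" "G \<subseteq> \<Union>H" using Cons.prems(1) by (auto simp: conn_def)
  have e: "G - set (z # zs) = (G - {z}) - set zs" by auto
  show ?case
  proof (cases "z \<in> G")
    case True
    have "construction_on H C (elim H f zs C)" if "C \<in> comps H (G - {z})" for C
      using Cons.IH[OF comps_conn[OF H G(1) that]] comps_comps[OF G(1) that, of _ "set zs"]
        Cons.prems(2) unfolding e by blast
    from construction_on_Node[OF True G(2) this] show ?thesis
      using True by simp
  next
    case False
    then have "G - set (z # zs) = G - set zs" by auto
    then show ?thesis using Cons False by simp
  qed
qed

end

section \<open>Flips inside elimination trees\<close>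

text \<open>The counterpart of \<open>flip_less\<close> for constructions on any common vertex set,
  so that flips in subtrees can be chained before being placed in the whole tree.\<close>

definition flip_step :: "'a::linorder set set \<Rightarrow> 'a ctree \<Rightarrow> 'a ctree \<Rightarrow> bool" where
  "flip_step H s t \<longleftrightarrow> (\<exists>G. construction_on H G s \<and> construction_on H G t) \<and>
     (\<exists>x y. y < x \<and> is_flip H x y s t)"

context
  fixes H :: "'a::linorder set set"
  assumes H: "hypergraph H"
begin

text \<open>The tree \<open>f C\<^sub>0\<close> is a subtree of the elimination tree, and changing
  it affects only the path from the root. At each eliminated vertex exactly one component contains
  \<open>C\<^sub>0\<close>; the children for the other components stay as they are.\<close>

lemma flip_step_elim:
  assumes "conn H G" "\<And>C. C \<in> comps H (G - set zs) \<Longrightarrow> construction_on H C (f C)"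
    and "C\<^sub>0 \<in> comps H (G - set zs)" "flip_step H (f C\<^sub>0) t"
  shows "flip_step H (elim H f zs G) (elim H (f(C\<^sub>0 := t)) zs G)"
proof -
  obtain x y where xy: "y < x" "is_flip H x y (f C\<^sub>0) t"
    using assms(4) by (auto simp: flip_step_def)
  have t: "construction_on H C\<^sub>0 t"
    using assms(4) assms(2)[OF assms(3)] by (auto simp: flip_step_def construction_on_def)
  define g where "g = f(C\<^sub>0 := t)"
  have g: "construction_on H C (g C)" if "C \<in> comps H (G - set zs)" for C
    using that t assms(2) by (simp add: g_def)
  have "is_flip H x y (elim H f zs G) (elim H g zs G)"
    using assms(1,2,3) g
  proof (induction zs arbitrary: G)
    case Nil
    then have "C\<^sub>0 = G" using comps_of_conn[OF H Nil(1)] by simp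
    then show ?case using xy(2) by (simp add: g_def)
  next
    case (Cons z zs)
    have G: "G - {z} \<subseteq> \<Union>H" "G \<subseteq> \<Union>H" using Cons.prems(1) by (auto simp: conn_def)
    have e: "G - set (z # zs) = (G - {z}) - set zs" by auto
    show ?case
    proof (cases "z \<in> G")
      case True
      let ?P = "comps H (G - {z})"
      obtain C where C: "C \<in> ?P" "C\<^sub>0 \<in> comps H (C - set zs)"
        using comps_comps_ex[OF H G(1)] Cons.prems(3) unfolding e by blast
      have sub: "D \<in> comps H (G - set (z # zs))" if "D \<in> comps H (C - set zs)" "C \<in> ?P" for C D
        using comps_comps[OF H G(1)] that unfolding e by blast
      have c: "construction_on H C (elim H f zs C)" "construction_on H C (elim H g zs C)"
        if "C \<in> ?P" for C
        using construction_on_elim[OF H comps_conn[OF H G(1) that]] sub[OF _ that]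
          Cons.prems(2,4) by blast+
      have fl: "is_flip H x y (elim H f zs C) (elim H g zs C)"
        using Cons.IH[OF comps_conn[OF H G(1) C(1)]] C sub[OF _ C(1)] Cons.prems(2,4) by blast
      have same: "elim H f zs D = elim H g zs D" if D: "D \<in> ?P" "D \<noteq> C" for D
      proof (rule elim_cong[OF H comps_conn[OF H G(1) D(1)]])
        fix E assume E: "E \<in> comps H (D - set zs)"
        have "D - set zs \<subseteq> \<Union>H" "C - set zs \<subseteq> \<Union>H"
          using comps_subset[OF H G(1)] D(1) C(1) G by blast+
        then have "E \<subseteq> D" "C\<^sub>0 \<subseteq> C" "E \<noteq> {}"
          using comps_subset[OF H _ E] comps_nonempty[OF H _ E] comps_subset[OF H _ C(2)] by blast+
        moreover have "D \<inter> C = {}" using comps_eq_or_disjoint[OF H G(1) D(1) C(1)] D(2) by blast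
        ultimately have "E \<noteq> C\<^sub>0" by blast
        then show "f E = g E" by (simp add: g_def)
      qed
      note fs = fset_comps_image[OF H G(1)]
      let ?F = "Abs_fset (elim H f zs ` ?P)"
      \<comment> \<open>Trees for different components have different vertex sets. Deleting the tree
        of \<open>C\<close> from the set of children therefore deletes nothing else.\<close>
      have "inj_on (elim H f zs) ?P"
        using c(1) unfolding construction_on_def by (intro inj_onI) metis
      from inj_on_image_set_diff[OF this, of ?P "{C}"]
      have inj: "elim H f zs ` (?P - {C}) = elim H f zs ` ?P - {elim H f zs C}"
        using C(1) by (simp only: image_insert image_empty Diff_subset insert_subset empty_subsetI)
      have "?P = insert C (?P - {C})" using C(1) by blast
      then have "elim H g zs ` ?P = insert (elim H g zs C) (elim H g zs ` (?P - {C}))"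
        by (metis image_insert)
      also have "elim H g zs ` (?P - {C}) = elim H f zs ` (?P - {C})"
        by (rule image_cong) (use same in simp_all)
      also note inj
      finally have "Abs_fset (elim H g zs ` ?P) = finsert (elim H g zs C) (?F |-| {|elim H f zs C|})"
        unfolding fset_inject[symmetric] finsert.rep_eq minus_fset fs bot_fset.rep_eq .
      moreover have "elim H f zs C |\<in>| ?F" by (simp add: fs C(1))
      ultimately show ?thesis
        using fl True unfolding is_flip_def by (simp add: at_subtree.below)
    next
      case False
      then have "G - set (z # zs) = G - set zs" by auto
      then show ?thesis using Cons False by simp
    qed
  qed
  moreover have "construction_on H G (elim H f zs G)" "construction_on H G (elim H g zs G)"
    using construction_on_elim[OF H assms(1)] assms(2) g by blast+
  ultimately show ?thesis using xy(1) unfolding flip_step_def g_def by blast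
qed

lemma flip_steps_elim:
  assumes "(flip_step H)\<^sup>+\<^sup>+ (f C\<^sub>0) t" "conn H G"
    and "\<And>C. C \<in> comps H (G - set zs) \<Longrightarrow> construction_on H C (f C)"
    and "C\<^sub>0 \<in> comps H (G - set zs)"
  shows "(flip_step H)\<^sup>+\<^sup>+ (elim H f zs G) (elim H (f(C\<^sub>0 := t)) zs G)"
  using assms(1)
proof (induction rule: tranclp_induct)
  case (base t)
  then show ?case using flip_step_elim[OF assms(2,3,4)] by blast
next
  case (step s t)
  \<comment> \<open>Each \<open>flip_step\<close> relates constructions on a common vertex set, so
    \<open>s\<close> still fits the component \<open>C\<^sub>0\<close>.\<close>
  have "construction_on H C\<^sub>0 s"
  proof -
    have "construction_on H C\<^sub>0 (f C\<^sub>0)" using assms(3,4) .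
    moreover from step(1) have "\<exists>G. construction_on H G (f C\<^sub>0) \<and> construction_on H G s"
      by (induction rule: tranclp_induct) (auto simp: flip_step_def construction_on_def)
    ultimately show ?thesis by (auto simp: construction_on_def)
  qed
  then have "flip_step H (elim H (f(C\<^sub>0 := s)) zs G) (elim H ((f(C\<^sub>0 := s))(C\<^sub>0 := t)) zs G)"
    by (intro flip_step_elim) (use assms step(2) in auto)
  then have "flip_step H (elim H (f(C\<^sub>0 := s)) zs G) (elim H (f(C\<^sub>0 := t)) zs G)"
    by (simp only: fun_upd_upd)
  with step.IH show ?case by (rule tranclp.trancl_into_trancl)
qed

text \<open>Both orders use the same trees \<open>g E\<close>, for the components \<open>E\<close>
  of \<open>G - {u, v}\<close>; they differ only in how these are distributed between
  \<open>u\<close> and \<open>v\<close>. With \<open>v\<close> at the root, the trees below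
  \<open>u\<close> are those inside the component of \<open>G - {v}\<close> containing
  \<open>u\<close>, as the flip prescribes.\<close>

lemma flip_root_elim:
  assumes G: "G \<subseteq> \<Union>H" and uv: "u \<in> G" "v \<in> G" "u \<noteq> v"
    and g: "\<And>C. C \<in> comps H (G - {u,v}) \<Longrightarrow> vertices (g C) = C"
  shows "flip_root H u v (elim H g [u, v] G) (elim H g [v, u] G)"
proof -
  have Gx: "G - {x} \<subseteq> \<Union>H" for x using G by auto
  \<comment> \<open>The shape of the tree for either order: \<open>C\<close> is the component of
    \<open>G - {x}\<close> that contains \<open>y\<close>, and only there does eliminating
    \<open>y\<close> have an effect.\<close>
  have ex: "\<exists>C. C \<in> comps H (G - {x}) \<and> y \<in> C \<and>
      elim H g [x, y] G = Node {x} (finsert (Node {y} (Abs_fset (g ` comps H (C - {y}))))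
        (Abs_fset (g ` (comps H (G - {x}) - {C})))) \<and>
      comps H (G - {x, y}) = (comps H (G - {x}) - {C}) \<union> comps H (C - {y})"
    if xy: "x \<in> G" "y \<in> G" "x \<noteq> y" for x y
  proof -
    have "y \<in> G - {x}" using xy by auto
    then obtain C where C: "C \<in> comps H (G - {x})" "y \<in> C"
      using comps_cover[OF H Gx] by blast
    let ?Q = "comps H (G - {x}) - {C}"
    have D: "elim H g [y] D = g D" if "D \<in> ?Q" for D
      using comps_eq_or_disjoint[OF H Gx C(1)] that C(2) by auto
    have "comps H (G - {x}) = insert C ?Q" using C(1) by auto
    then have "elim H g [y] ` comps H (G - {x}) = insert (elim H g [y] C) (elim H g [y] ` ?Q)"
      by (metis image_insert)
    also have "elim H g [y] ` ?Q = g ` ?Q" using D by (intro image_cong) auto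
    finally have "elim H g [y] ` comps H (G - {x}) = insert (elim H g [y] C) (g ` ?Q)" .
    moreover have "finite ?Q" using comps_finite[OF H Gx] by auto
    moreover have "elim H g [y] C = Node {y} (Abs_fset (g ` comps H (C - {y})))"
      using C(2) by simp
    ultimately have "elim H g [x, y] G = Node {x} (Abs_fset (insert (Node {y} (Abs_fset (g ` comps H (C - {y}))))
        (g ` ?Q)))" and "finite ?Q"
      using xy(1) by (metis elim.simps(2))+
    then have "elim H g [x, y] G = Node {x} (finsert (Node {y} (Abs_fset (g ` comps H (C - {y}))))
        (Abs_fset (g ` ?Q)))"
      by (simp add: finsert.abs_eq eq_onp_def)
    moreover have "comps H (G - {x, y}) = ?Q \<union> comps H (C - {y})"
      using comps_Diff[OF H Gx C(1), of "{y}"] C(2) Diff_insert2[of G x "{y}"] by simp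
    ultimately show ?thesis using C by blast
  qed
  obtain C where C: "C \<in> comps H (G - {u})" "v \<in> C"
    "elim H g [u, v] G = Node {u} (finsert (Node {v} (Abs_fset (g ` comps H (C - {v}))))
        (Abs_fset (g ` (comps H (G - {u}) - {C}))))"
    "comps H (G - {u, v}) = (comps H (G - {u}) - {C}) \<union> comps H (C - {v})"
    using ex[OF uv] by blast
  obtain D where D: "D \<in> comps H (G - {v})" "u \<in> D"
    "elim H g [v, u] G = Node {v} (finsert (Node {u} (Abs_fset (g ` comps H (D - {u}))))
        (Abs_fset (g ` (comps H (G - {v}) - {D}))))"
    "comps H (G - {u, v}) = (comps H (G - {v}) - {D}) \<union> comps H (D - {u})"
    using ex[OF uv(2,1) uv(3)[symmetric]] by (auto simp: insert_commute)
  have sub: "C - {v} \<subseteq> \<Union>H" "D - {u} \<subseteq> \<Union>H"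
    using comps_subset[OF H Gx C(1)] comps_subset[OF H Gx D(1)] G by auto
  have fs: "fset (Abs_fset (g ` comps H (C - {v}))) = g ` comps H (C - {v})"
    "fset (Abs_fset (g ` comps H (D - {u}))) = g ` comps H (D - {u})"
    "fset (Abs_fset (g ` (comps H (G - {u}) - {C}))) = g ` (comps H (G - {u}) - {C})"
    "fset (Abs_fset (g ` (comps H (G - {v}) - {D}))) = g ` (comps H (G - {v}) - {D})"
    by (rule Abs_fset_inverse; simp add: comps_finite[OF H] sub Gx)+
  \<comment> \<open>These are the sets appearing in \<open>flip_root\<close>, with \<open>D\<close>
    in the role of \<open>K\<close>.\<close>
  define Us where "Us = Abs_fset (g ` comps H (C - {v}))"
  define Ts where "Ts = finsert (Node {v} Us) (Abs_fset (g ` (comps H (G - {u}) - {C})))"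
  define A where "A = (Ts |-| {|Node {v} Us|}) |\<union>| Us"
  define B where "B = ffilter (\<lambda>t. vertices t \<subseteq> D) A"
  have v_notin: "v \<notin> vertices (g E)" if "E \<in> comps H (G - {u, v})" for E
  proof -
    have "G - {u, v} \<subseteq> \<Union>H" using G by auto
    from comps_subset[OF H this that] show ?thesis using g[OF that] by blast
  qed
  \<comment> \<open>No \<open>g E\<close> contains the vertex \<open>v\<close>, so removing the
    child \<open>v\<close> from \<open>Ts\<close> leaves all the other children in place.\<close>
  have "Node {v} Us \<notin> g ` (comps H (G - {u}) - {C})"
  proof
    assume "Node {v} Us \<in> g ` (comps H (G - {u}) - {C})"
    then obtain E where E': "E \<in> comps H (G - {u}) - {C}" "g E = Node {v} Us" by (metis imageE)
    have E: "E \<in> comps H (G - {u, v})" "g E = Node {v} Us"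
      using E' C(4) by blast+
    have "v \<notin> vertices (Node {v} Us)" using v_notin[OF E(1)] unfolding E(2) .
    then show False unfolding vertices_Node by blast
  qed
  then have A: "fset A = g ` comps H (G - {u, v})"
    unfolding A_def Ts_def C(4) by (simp add: fs Us_def image_Un Un_commute)
  \<comment> \<open>The remaining possibility for \<open>E\<close> is a component of
    \<open>G - {v}\<close> other than \<open>D\<close>. It is non-empty and disjoint from
    \<open>D\<close>, hence not contained in it.\<close>
  have inD: "vertices (g E) \<subseteq> D \<longleftrightarrow> E \<in> comps H (D - {u})" if "E \<in> comps H (G - {u, v})" for E
  proof -
    have ne: "E \<noteq> {}" using comps_nonempty[OF H _ that] G by auto
    have "\<not> E \<subseteq> D" if "E \<in> comps H (G - {v}) - {D}"
      using comps_eq_or_disjoint[OF H Gx, of E v D] D(1) that ne by blast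
    moreover have "E \<subseteq> D" if "E \<in> comps H (D - {u})"
      using comps_subset[OF H sub(2) that] by blast
    ultimately show ?thesis using g[OF that] that D(4) by auto
  qed
  have B: "fset B = g ` comps H (D - {u})"
  proof -
    have "fset B = {t \<in> fset A. vertices t \<subseteq> D}" unfolding B_def by auto
    also have "\<dots> = g ` {E \<in> comps H (G - {u, v}). vertices (g E) \<subseteq> D}"
      unfolding A by blast
    also have "{E \<in> comps H (G - {u, v}). vertices (g E) \<subseteq> D} = comps H (D - {u})"
      using inD D(4) by blast
    finally show ?thesis .
  qed
  have not_in: "E \<notin> comps H (D - {u})" if "E \<in> comps H (G - {v}) - {D}" for E
  proof
    assume E: "E \<in> comps H (D - {u})"
    have "E \<subseteq> D" "E \<noteq> {}" using comps_subset[OF H sub(2) E] comps_nonempty[OF H sub(2) E] by auto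
    then show False using comps_eq_or_disjoint[OF H Gx, of E v D] D(1) that by blast
  qed
  \<comment> \<open>Since \<open>g E\<close> determines \<open>E\<close>, the difference of the sets
    of trees is the image of the difference of the sets of components.\<close>
  have inj: "inj_on g (comps H (G - {u, v}))" using g by (metis inj_onI)
  have AB: "fset (A |-| B) = g ` (comps H (G - {v}) - {D})"
  proof -
    have sub': "comps H (D - {u}) \<subseteq> comps H (G - {u, v})" using D(4) by blast
    have "fset (A |-| B) = g ` comps H (G - {u, v}) - g ` comps H (D - {u})"
      unfolding minus_fset A B ..
    also have "\<dots> = g ` (comps H (G - {u, v}) - comps H (D - {u}))"
      by (rule inj_on_image_set_diff[OF inj, symmetric, of _ _]) (use sub' in blast)+
    also have "comps H (G - {u, v}) - comps H (D - {u}) = comps H (G - {v}) - {D}"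
      using D(4) not_in by blast
    finally show ?thesis .
  qed
  have vert: "vertices (Node {u} Ts) = G"
  proof -
    have "(\<Union>t\<in>fset Us. vertices t) = (\<Union>E\<in>comps H (C - {v}). vertices (g E))"
      unfolding Us_def fs by simp
    also have "\<dots> = \<Union>(comps H (C - {v}))" using g C(4) by auto
    also have "\<dots> = C - {v}" using partition_onD1[OF comps_partition[OF H sub(1)]] by simp
    finally have 1: "vertices (Node {v} Us) = C" unfolding vertices_Node using C(2) by auto
    have "(\<Union>t\<in>g ` (comps H (G - {u}) - {C}). vertices t) = \<Union>(comps H (G - {u}) - {C})"
      using g C(4) by auto
    then have "vertices (Node {u} Ts) = {u} \<union> (C \<union> \<Union>(comps H (G - {u}) - {C}))"
      unfolding vertices_Node[of "{u}"] Ts_def using 1 by (simp add: fs)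
    also have "\<dots> = {u} \<union> \<Union>(comps H (G - {u}))" using C(1) by auto
    also have "\<dots> = G" using partition_onD1[OF comps_partition[OF H Gx[of u]]] uv(1) by auto
    finally show ?thesis .
  qed
  have "flip_root H u v (Node {u} Ts) (Node {v} (finsert (Node {u} B) (A |-| B)))"
  proof (rule flip_root.intros[where P = "comps H (G - {v})" and K = D])
    show "Node {v} Us |\<in>| Ts" by (simp add: Ts_def)
    show "decomposes (restrict_hg H (vertices (Node {u} Ts))) {v} (comps H (G - {v}))"
      unfolding vert decomposes_iff[OF H G] by simp
  qed (use D A_def B_def in auto)
  moreover have "B = Abs_fset (g ` comps H (D - {u}))" "A |-| B = Abs_fset (g ` (comps H (G - {v}) - {D}))"
    using B AB fs by (simp_all add: fset_inject[symmetric])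
  ultimately show ?thesis using C(3) D(3) by (simp add: Ts_def Us_def)
qed

end

section \<open>Decreasing refinements\<close>

abbreviation desc :: "'a::linorder set \<Rightarrow> 'a list" where
  "desc Y \<equiv> rev (sorted_list_of_set Y)"

lemma desc_Un:
  assumes "finite U" "finite V" "U \<noteq> {}" "V \<noteq> {}" "set_less V U"
  shows "desc (V \<union> U) = desc U @ desc V"
proof -
  have l: "v < u" if "v \<in> V" "u \<in> U" for u v
    using assms that Max_ge[of V v] Min_le[of U u]
    unfolding set_less_def by (meson le_less_trans less_le_trans)
  have "sorted_list_of_set (V \<union> U) = sorted_list_of_set V @ sorted_list_of_set U"
  proof (rule sorted_distinct_set_unique)
    show "sorted (sorted_list_of_set V @ sorted_list_of_set U)"
      using l assms(1,2) by (auto simp: sorted_append less_imp_le)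
    show "distinct (sorted_list_of_set V @ sorted_list_of_set U)"
      using l assms(1,2) by auto
  qed (use assms(1,2) in auto)
  then show ?thesis by simp
qed

text \<open>The children are recovered from their vertex sets, so the description operator is meaningful
  only for constructs; see \<open>decr_Node\<close>.\<close>

primrec decr :: "'a::linorder set set \<Rightarrow> 'a ctree \<Rightarrow> 'a ctree" where
  "decr H (Node Y Ts) = elim H (\<lambda>C. THE s. s |\<in>| decr H |`| Ts \<and> vertices s = C) (desc Y)
     (Y \<union> (\<Union>s\<in>fset (decr H |`| Ts). vertices s))"

declare decr.simps [simp del]

section \<open>Exchanging vertices in an elimination order\<close>

context
  fixes H :: "'a::linorder set set"
  assumes H: "hypergraph H"
begin

lemma elim_disjoint: "set zs \<inter> G = {} \<Longrightarrow> elim H f zs G = f G"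
  by (induction zs) auto

lemma elim_swap_notin:
  assumes G: "G \<subseteq> \<Union>H" and "u \<notin> G"
  shows "elim H f [v, u] G = elim H f [u, v] G"
proof -
  have W: "G - {v} \<subseteq> \<Union>H" using G by auto
  have "elim H f [u] C = elim H f [] C" if "C \<in> comps H (G - {v})" for C
    using comps_subset[OF H W that] assms(2) by auto
  then have "elim H f [u] ` comps H (G - {v}) = elim H f [] ` comps H (G - {v})" by simp
  then show ?thesis using assms(2) by (auto simp only: elim.simps split: if_split)
qed

text \<open>After removal of \<open>a\<close>, at most one component contains both \<open>u\<close>
  and \<open>v\<close>. If there is one, the exchange is a flip in its tree; in all other components
  the two orders produce the same tree.\<close>

lemma elim_swap:
  assumes vu: "v < u" and G: "conn H G"
    and f: "\<And>C. C \<in> comps H (G - set (a @ u # v # b)) \<Longrightarrow> construction_on H C (f C)"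
  shows "(flip_step H)\<^sup>*\<^sup>* (elim H f (a @ u # v # b) G) (elim H f (a @ v # u # b) G)"
proof -
  \<comment> \<open>The vertices \<open>b\<close> are absorbed into the filling function, and
    \<open>h\<close>, \<open>h'\<close> put the two orders of \<open>u\<close> and \<open>v\<close>
    in front of it. What remains is elimination of \<open>a\<close> with two different
    fillings.\<close>
  define g where "g = elim H f b"
  define h where "h = elim H g [u, v]"
  define h' where "h' = elim H g [v, u]"
  have GH: "G - set a \<subseteq> \<Union>H" "G \<subseteq> \<Union>H" using G by (auto simp: conn_def)
  have e: "elim H f (a @ u # v # b) G = elim H h a G" "elim H f (a @ v # u # b) G = elim H h' a G"
  proof -
    have "elim H f (x # y # b) = elim H g [x, y]" for x y
      unfolding g_def using elim_append[of H f "[x, y]" b] by (intro ext) (simp only: append.simps)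
    then show "elim H f (a @ u # v # b) G = elim H h a G"
      "elim H f (a @ v # u # b) G = elim H h' a G"
      unfolding h_def h'_def elim_append[of H f a] by (simp_all only:)
  qed
  have gg: "construction_on H D (g D)" if "C \<in> comps H (G - set a)" "D \<in> comps H (C - {u, v})" for C D
  proof -
    have CH: "C \<subseteq> \<Union>H" "C - {u, v} \<subseteq> \<Union>H" using comps_subset[OF H GH(1) that(1)] GH by auto
    have e: "G - set a - {u, v} - set b = G - set (a @ u # v # b)" by auto
    have D: "D \<in> comps H (G - set a - {u, v})" using comps_comps[OF H GH(1)] that by blast
    have GG: "G - set a - {u, v} \<subseteq> \<Union>H" using GH by auto
    show ?thesis unfolding g_def
      by (rule construction_on_elim[OF H comps_conn[OF H GG D]])
        (use comps_comps[OF H GG D, of _ "set b"] f e in auto)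
  qed
  have hh: "construction_on H C (h C)" "construction_on H C (h' C)" if "C \<in> comps H (G - set a)" for C
    unfolding h_def h'_def using gg[OF that]
    by (auto intro!: construction_on_elim[OF H comps_conn[OF H GH(1) that]] simp: insert_commute
        simp del: elim.simps)
  have same: "h C = h' C" if "C \<in> comps H (G - set a)" "\<not> (u \<in> C \<and> v \<in> C)" for C
  proof -
    have "C \<subseteq> \<Union>H" using comps_subset[OF H GH(1) that(1)] GH by auto
    then show ?thesis using elim_swap_notin[of C u g v] elim_swap_notin[of C v g u] that(2)
      unfolding h_def h'_def by metis
  qed
  show ?thesis
  proof (cases "\<exists>C\<in>comps H (G - set a). u \<in> C \<and> v \<in> C")
    case False
    then have "elim H h a G = elim H h' a G" using same elim_cong[OF H G, of a h h'] by blast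
    then show ?thesis unfolding e by simp
  next
    case True
    then obtain C where C: "C \<in> comps H (G - set a)" "u \<in> C" "v \<in> C" by blast
    have CH: "C \<subseteq> \<Union>H" using comps_subset[OF H GH(1) C(1)] GH by auto
    have "flip_root H u v (h C) (h' C)"
      unfolding h_def h'_def
      by (rule flip_root_elim[OF H CH C(2,3)])
        (use vu gg[OF C(1)] in \<open>auto simp: construction_on_def\<close>)
    then have "is_flip H u v (h C) (h' C)" unfolding is_flip_def by (rule at_subtree.here)
    then have "flip_step H (h C) (h' C)" using hh[OF C(1)] vu unfolding flip_step_def by blast
    from flip_step_elim[where f = h, OF H G hh(1) C(1) this]
    have "flip_step H (elim H h a G) (elim H (h(C := h' C)) a G)" .
    moreover have "elim H (h(C := h' C)) a G = elim H h' a G"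
    proof (rule elim_cong[OF H G])
      fix D assume D: "D \<in> comps H (G - set a)"
      show "(h(C := h' C)) D = h' D"
        using same[OF D] comps_eq_or_disjoint[OF H GH(1) C(1) D] C(2) by auto
    qed
    ultimately show ?thesis unfolding e by simp
  qed
qed

text \<open>The vertex \<open>v\<close> moves left past one larger vertex at a time. In the
  induction it first crosses the tail of \<open>us\<close>, with the head added to the prefix
  \<open>a\<close>, and crosses the head last.\<close>

lemma elim_swap_element:
  assumes "\<And>u. u \<in> set us \<Longrightarrow> v < u" and "conn H G"
    and "\<And>C. C \<in> comps H (G - set (a @ us @ v # b)) \<Longrightarrow> construction_on H C (f C)"
  shows "(flip_step H)\<^sup>*\<^sup>* (elim H f (a @ us @ v # b) G) (elim H f (a @ v # us @ b) G)"
  using assms(1,3)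
proof (induction us arbitrary: a)
  case (Cons u us)
  have "(flip_step H)\<^sup>*\<^sup>* (elim H f ((a @ [u]) @ us @ v # b) G) (elim H f ((a @ [u]) @ v # us @ b) G)"
    by (rule Cons.IH) (use Cons.prems in auto)
  moreover have "G - set (a @ u # v # us @ b) = G - set (a @ (u # us) @ v # b)" by auto
  then have "(flip_step H)\<^sup>*\<^sup>* (elim H f (a @ u # v # us @ b) G) (elim H f (a @ v # u # us @ b) G)"
    by (intro elim_swap assms(2) Cons.prems) (use Cons.prems(1) in auto)
  ultimately show ?case by simp
qed simp

text \<open>The vertices of \<open>vs\<close> cross the block \<open>us\<close> from left to right,
  each joining the prefix \<open>a\<close> once it has crossed.\<close>

lemma elim_swap_blocks:
  assumes "\<And>u v. u \<in> set us \<Longrightarrow> v \<in> set vs \<Longrightarrow> v < u" and "conn H G"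
    and "\<And>C. C \<in> comps H (G - set (a @ us @ vs)) \<Longrightarrow> construction_on H C (f C)"
  shows "(flip_step H)\<^sup>*\<^sup>* (elim H f (a @ us @ vs) G) (elim H f (a @ vs @ us) G)"
  using assms(1,3)
proof (induction vs arbitrary: a)
  case (Cons v vs)
  have "(flip_step H)\<^sup>*\<^sup>* (elim H f (a @ us @ v # vs) G) (elim H f (a @ v # us @ vs) G)"
    by (intro elim_swap_element assms(2)) (use Cons.prems in auto)
  moreover have e: "G - set ((a @ [v]) @ us @ vs) = G - set (a @ us @ v # vs)" by auto
  have "(flip_step H)\<^sup>*\<^sup>* (elim H f ((a @ [v]) @ us @ vs) G) (elim H f ((a @ [v]) @ vs @ us) G)"
    by (rule Cons.IH) (use Cons.prems e in auto)
  ultimately show ?case by simp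
qed simp

text \<open>The path given by \<open>elim_swap_blocks\<close> cannot be empty: the heads of the two
  lists lie in \<open>G\<close>, become the two roots, and are distinct.\<close>

lemma flip_steps_elim_swap:
  assumes "\<And>u v. u \<in> set us \<Longrightarrow> v \<in> set vs \<Longrightarrow> v < u" and G: "conn H G"
    and f: "\<And>C. C \<in> comps H (G - set (us @ vs)) \<Longrightarrow> construction_on H C (f C)"
    and us: "us \<noteq> []" "set us \<subseteq> G" and vs: "vs \<noteq> []" "set vs \<subseteq> G"
  shows "(flip_step H)\<^sup>+\<^sup>+ (elim H f (us @ vs) G) (elim H f (vs @ us) G)"
proof -
  have "(flip_step H)\<^sup>*\<^sup>* (elim H f (us @ vs) G) (elim H f (vs @ us) G)"
    using elim_swap_blocks[of us vs G "[]" f] assms(1) G f by simp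
  moreover have "elim H f (us @ vs) G \<noteq> elim H f (vs @ us) G" \<comment> \<open>the roots differ\<close>
    using us vs assms(1) by (cases us; cases vs) auto
  ultimately show ?thesis by (metis rtranclpD)
qed

section \<open>The construction assigned to a construct\<close>

lemma construct_in_finite: "construct_in H (Node Y Ts) \<Longrightarrow> finite Y"
  using H unfolding construct_in_Node[OF H] hypergraph_def by (metis finite_subset)

text \<open>The bijection between children and components makes the description in
  \<open>decr\<close> unique, so any \<open>f\<close> with the right values on children may replace
  it. The assumption that \<open>decr\<close> keeps the vertex sets of the children is available
  inside the induction for \<open>construction_on_decr\<close>; afterwards \<open>decr_Node\<close>
  dispenses with it.\<close>

lemma decr_Node_aux:
  assumes t: "construct_in H (Node Y Ts)"
    and v: "\<And>t. t \<in> fset Ts \<Longrightarrow> vertices (decr H t) = vertices t"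
    and f: "\<And>t. t \<in> fset Ts \<Longrightarrow> f (vertices t) = decr H t"
    and G: "conn H (vertices (Node Y Ts))"
  shows "decr H (Node Y Ts) = elim H f (desc Y) (vertices (Node Y Ts))"
proof -
  let ?G = "vertices (Node Y Ts)"
  have b: "bij_betw vertices (fset Ts) (comps H (?G - Y))"
    using t unfolding construct_in_Node[OF H] by blast
  have "Y \<union> (\<Union>s\<in>fset (decr H |`| Ts). vertices s) = ?G"
    unfolding vertices_Node using v by simp
  then have "decr H (Node Y Ts) =
     elim H (\<lambda>C. THE s. s |\<in>| decr H |`| Ts \<and> vertices s = C) (desc Y) ?G"
    by (simp only: decr.simps)
  also have "\<dots> = elim H f (desc Y) ?G"
  proof (rule elim_cong[OF H G])
    fix C assume "C \<in> comps H (?G - set (desc Y))"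
    then have "C \<in> comps H (?G - Y)" using construct_in_finite[OF t] by simp
    then obtain t where t: "t \<in> fset Ts" "vertices t = C"
      using b unfolding bij_betw_def by (metis imageE)
    have "(THE s. s |\<in>| decr H |`| Ts \<and> vertices s = C) = decr H t"
    proof (rule the_equality)
      fix s assume s: "s |\<in>| decr H |`| Ts \<and> vertices s = C"
      then obtain t' where t': "t' \<in> fset Ts" "s = decr H t'" by auto
      then have "vertices t' = vertices t" using v t(2) s by metis
      then have "t' = t" using b t'(1) t(1) unfolding bij_betw_def inj_on_def by blast
      then show "s = decr H t" using t' by simp
    qed (use t v in auto)
    then show "(THE s. s |\<in>| decr H |`| Ts \<and> vertices s = C) = f C"
      using f t by metis
  qed
  finally show ?thesis .
qed

lemma construct_in_child:
  assumes "construct_in H (Node Y Ts)" "t \<in> fset Ts"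
  shows "construct_in H t" "conn H (vertices t)" "vertices t \<in> comps H (vertices (Node Y Ts) - Y)"
proof -
  show "construct_in H t" and c: "vertices t \<in> comps H (vertices (Node Y Ts) - Y)"
    using assms unfolding construct_in_Node[OF H] by (blast dest: bij_betwE)+
  have "vertices (Node Y Ts) - Y \<subseteq> \<Union>H" using assms(1) unfolding construct_in_def by auto
  then show "conn H (vertices t)" using comps_conn[OF H _ c] by blast
qed

lemma comps_child:
  assumes "construct_in H (Node Y Ts)" "C \<in> comps H (vertices (Node Y Ts) - Y)"
  obtains t where "t \<in> fset Ts" "vertices t = C"
  using assms unfolding construct_in_Node[OF H] bij_betw_def by (metis imageE)

text \<open>Children have distinct vertex sets, so data attached to children can be indexed by
  components, as \<open>elim\<close> expects.\<close>

lemma ex_child_function: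
  assumes "construct_in H (Node Y Ts)"
  obtains f where "\<And>t. t \<in> fset Ts \<Longrightarrow> f (vertices t) = g t"
proof
  fix t assume t: "t \<in> fset Ts"
  have "inj_on vertices (fset Ts)" using assms unfolding construct_in_Node[OF H] bij_betw_def by blast
  then show "(\<lambda>C. g (inv_into (fset Ts) vertices C)) (vertices t) = g t"
    using inv_into_f_f[of vertices "fset Ts" t] t by metis
qed

lemma construction_on_decr:
  "construct_in H t \<Longrightarrow> conn H (vertices t) \<Longrightarrow> construction_on H (vertices t) (decr H t)"
proof (induction t)
  case (Node Y Ts)
  note ch = construct_in_child[OF Node.prems(1)]
  have c: "construction_on H (vertices t) (decr H t)" if "t \<in> fset Ts" for t
    using Node.IH that ch by blast
  obtain f where f: "\<And>t. t \<in> fset Ts \<Longrightarrow> f (vertices t) = decr H t"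
    using ex_child_function[OF Node.prems(1), of "decr H"] by blast
  have e: "decr H (Node Y Ts) = elim H f (desc Y) (vertices (Node Y Ts))"
    by (rule decr_Node_aux[OF Node.prems(1) _ f Node.prems(2)])
      (use c in \<open>auto simp: construction_on_def\<close>)
  show ?case unfolding e
  proof (rule construction_on_elim[OF H Node.prems(2)])
    fix C assume "C \<in> comps H (vertices (Node Y Ts) - set (desc Y))"
    then have "C \<in> comps H (vertices (Node Y Ts) - Y)"
      using construct_in_finite[OF Node.prems(1)] by simp
    then obtain t where "t \<in> fset Ts" "vertices t = C" by (rule comps_child[OF Node.prems(1)])
    then show "construction_on H C (f C)" using c f by metis
  qed
qed

lemma decr_Node:
  assumes "construct_in H (Node Y Ts)" "conn H (vertices (Node Y Ts))"
    and "\<And>t. t \<in> fset Ts \<Longrightarrow> f (vertices t) = decr H t"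
  shows "decr H (Node Y Ts) = elim H f (desc Y) (vertices (Node Y Ts))"
  using decr_Node_aux[OF assms(1) _ assms(3,2)]
    construction_on_decr construct_in_child[OF assms(1)] by (simp add: construction_on_def)

text \<open>Each label is a singleton \<open>{x}\<close>, and eliminating \<open>x\<close> alone
  rebuilds the node from its children, which are fixed by induction.\<close>

lemma decr_construction:
  "construction_on H (vertices t) t \<Longrightarrow> conn H (vertices t) \<Longrightarrow> decr H t = t"
proof (induction t)
  case (Node Y Ts)
  have c: "construct_in H (Node Y Ts)" using Node.prems(1) by (simp add: construction_on_def)
  note ch = construct_in_child[OF c]
  have "is_singleton Y" "\<And>t. t \<in> fset Ts \<Longrightarrow> \<forall>X\<in>nodes t. is_singleton X"
    using Node.prems(1) by (auto simp: construction_on_def nodes_Node)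
  then obtain x where Y: "Y = {x}" and "\<And>t. t \<in> fset Ts \<Longrightarrow> \<forall>X\<in>nodes t. is_singleton X"
    by (auto simp: is_singleton_def)
  then have IH: "decr H t = t" if "t \<in> fset Ts" for t
    using Node.IH[OF that] that ch by (simp add: construction_on_def)
  obtain f where f: "\<And>t. t \<in> fset Ts \<Longrightarrow> f (vertices t) = t"
    using ex_child_function[OF c, of id] by auto
  have "decr H (Node Y Ts) = elim H f [x] (vertices (Node Y Ts))"
    using decr_Node[OF c Node.prems(2), of f] f IH unfolding Y by simp
  also have "\<dots> = Node {x} (Abs_fset (f ` comps H (vertices (Node Y Ts) - {x})))"
    unfolding vertices_Node Y by simp
  also have "comps H (vertices (Node Y Ts) - {x}) = vertices ` fset Ts"
    using c unfolding construct_in_Node[OF H] bij_betw_def Y by blast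
  also have "f ` vertices ` fset Ts = fset Ts" using f by (simp add: image_image)
  finally show ?case by (simp add: fset_inverse Y)
qed

section \<open>Fusions and splits under \<open>decr\<close>\<close>

text \<open>The children after the contraction belong to the components of \<open>G - X\<close>
  other than that of the child \<open>Y\<close>, and to the components left in the latter once
  \<open>Y\<close> is removed. By \<open>comps_Diff\<close> these are the components of
  \<open>G - (X \<union> Y)\<close>. The third claim expresses \<open>decr\<close> of the
  uncontracted tree with a filling function for the contracted one.\<close>

lemma contract_root_construct_in:
  assumes t: "construct_in H (Node X Ts)" and Y: "Node Y Us \<in> fset Ts"
    and A: "A = (Ts |-| {|Node Y Us|}) |\<union>| Us"
  shows "construct_in H (Node (X \<union> Y) A)" "vertices (Node (X \<union> Y) A) = vertices (Node X Ts)"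
    and "conn H (vertices (Node X Ts)) \<Longrightarrow> (\<And>t. t \<in> fset A \<Longrightarrow> f (vertices t) = decr H t) \<Longrightarrow>
      decr H (Node X Ts) = elim H f (desc X @ desc Y) (vertices (Node X Ts))"
proof -
  let ?G = "vertices (Node X Ts)" and ?C = "vertices (Node Y Us)"
  have fA: "fset A = (fset Ts - {Node Y Us}) \<union> fset Us" unfolding A by simp
  have GH: "?G - X \<subseteq> \<Union>H" using t unfolding construct_in_def by blast
  note c = construct_in_child[OF t Y]
  note C = c(3)
  have YC: "Y \<subseteq> ?C" unfolding vertices_Node by blast
  have CH: "?C - Y \<subseteq> \<Union>H" using comps_subset[OF H GH C] GH by blast
  have "fset Ts = insert (Node Y Us) (fset Ts - {Node Y Us})" using Y by blast
  then have "?G = X \<union> (?C \<union> (\<Union>t\<in>fset Ts - {Node Y Us}. vertices t))"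
    unfolding vertices_Node[of X Ts] by (metis UN_insert)
  then show v: "vertices (Node (X \<union> Y) A) = ?G"
    unfolding vertices_Node[of "X \<union> Y"] vertices_Node[of Y] fA UN_Un by blast
  have bT: "bij_betw vertices (fset Ts) (comps H (?G - X))"
    and bU: "bij_betw vertices (fset Us) (comps H (?C - Y))"
    using t c(1) unfolding construct_in_Node[OF H] by blast+
  have disj: "D \<inter> ?C = {}" if "D \<in> comps H (?G - X) - {?C}" for D
    using comps_eq_or_disjoint[OF H GH C] that by blast
  have "bij_betw vertices (fset Ts - {Node Y Us}) (comps H (?G - X) - {?C})"
  proof (rule bij_betw_subset[OF bT])
    show "vertices ` (fset Ts - {Node Y Us}) = comps H (?G - X) - {?C}"
      using bT Y unfolding bij_betw_def inj_on_def by blast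
  qed blast
  moreover have "(comps H (?G - X) - {?C}) \<inter> comps H (?C - Y) = {}"
  proof -
    have "D \<notin> comps H (?C - Y)" if D: "D \<in> comps H (?G - X) - {?C}" for D
    proof
      assume "D \<in> comps H (?C - Y)"
      from comps_subset[OF H CH this] comps_nonempty[OF H CH this] disj[OF D] show False by blast
    qed
    then show ?thesis by blast
  qed
  ultimately have "bij_betw vertices (fset A) ((comps H (?G - X) - {?C}) \<union> comps H (?C - Y))"
    unfolding fA using bU by (intro bij_betw_combine)
  also have "(comps H (?G - X) - {?C}) \<union> comps H (?C - Y) = comps H (?G - X - Y)"
    using comps_Diff[OF H GH C YC] by simp
  also have "?G - X - Y = ?G - (X \<union> Y)" by blast
  finally have "bij_betw vertices (fset A) (comps H (?G - (X \<union> Y)))" .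
  then show "construct_in H (Node (X \<union> Y) A)"
    using t c(1) unfolding construct_in_Node[OF H] v fA by blast
  assume G: "conn H ?G" and f: "\<And>t. t \<in> fset A \<Longrightarrow> f (vertices t) = decr H t"
  \<comment> \<open>The filling function for the children of \<open>X\<close>: as \<open>f\<close>,
    except that the component of the child \<open>Y\<close> receives the whole tree of that
    child.\<close>
  define k where "k = f(?C := decr H (Node Y Us))"
  have "k (vertices t) = decr H t" if "t \<in> fset Ts" for t
  proof (cases "t = Node Y Us")
    case False
    then have "vertices t \<noteq> ?C" using bT Y that unfolding bij_betw_def inj_on_def by blast
    then show ?thesis using f that False by (simp add: k_def fA)
  qed (simp add: k_def)
  then have "decr H (Node X Ts) = elim H k (desc X) ?G" by (rule decr_Node[OF t G])
  also have "\<dots> = elim H (elim H f (desc Y)) (desc X) ?G"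
  proof (rule elim_cong[OF H G])
    fix D assume "D \<in> comps H (?G - set (desc X))"
    then have D: "D \<in> comps H (?G - X)" using construct_in_finite[OF t] by simp
    show "k D = elim H f (desc Y) D"
    proof (cases "D = ?C")
      case True
      then show ?thesis using decr_Node[OF c(1,2), of f] f by (simp add: k_def fA)
    next
      case False
      \<comment> \<open>The other components contain no vertex of \<open>Y\<close>, so eliminating
        \<open>Y\<close> there has no effect.\<close>
      then have "D \<inter> Y = {}" using disj[of D] D YC by blast
      then have "set (desc Y) \<inter> D = {}" using construct_in_finite[OF c(1)] by auto
      then show ?thesis using False by (simp add: k_def elim_disjoint)
    qed
  qed
  finally show "decr H (Node X Ts) = elim H f (desc X @ desc Y) ?G" by (simp add: elim_append)
qed

end

lemma construct_in_replace_child: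
  assumes H: "hypergraph H" and c: "construct_in H (Node Z Ts)" and t: "t \<in> fset Ts"
    and t': "construct_in H t'" "vertices t' = vertices t"
  shows "construct_in H (Node Z (finsert t' (Ts |-| {|t|})))"
    and "vertices (Node Z (finsert t' (Ts |-| {|t|}))) = vertices (Node Z Ts)"
proof -
  have f: "fset (finsert t' (Ts |-| {|t|})) = insert t' (fset Ts - {t})" by simp
  have i: "fset Ts = insert t (fset Ts - {t})" using t by blast
  show v: "vertices (Node Z (finsert t' (Ts |-| {|t|}))) = vertices (Node Z Ts)"
    unfolding vertices_Node f by (subst (2) i) (simp only: UN_insert t'(2))
  have b: "bij_betw vertices (fset Ts) (comps H (vertices (Node Z Ts) - Z))"
    using c unfolding construct_in_Node[OF H] by blast
  have "bij_betw vertices (insert t' (fset Ts - {t})) (comps H (vertices (Node Z Ts) - Z))"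
  proof -
    have "inj_on vertices (fset Ts - {t})" "vertices t \<notin> vertices ` (fset Ts - {t})"
      using b t unfolding bij_betw_def inj_on_def by blast+
    then have "inj_on vertices (insert t' (fset Ts - {t}))"
      unfolding inj_on_insert t'(2) by blast
    moreover have "vertices ` insert t' (fset Ts - {t}) = vertices ` fset Ts"
      by (subst (2) i) (simp only: image_insert t'(2))
    ultimately show ?thesis using b unfolding bij_betw_def by metis
  qed
  then show "construct_in H (Node Z (finsert t' (Ts |-| {|t|})))"
    using c t'(1) unfolding construct_in_Node[OF H] v f by blast
qed

context
  fixes H :: "'a::linorder set set"
  assumes H: "hypergraph H"
begin

lemma contracts_construct_in:
  assumes "contracts X Y S T" "construct_in H S"
  shows "construct_in H T \<and> vertices T = vertices S"
  using assms unfolding contracts_def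
proof (induction rule: at_subtree.induct)
  case (here t t')
  from here(1) show ?case
  proof cases
    case (1 Us Ts)
    then show ?thesis using contract_root_construct_in(1,2)[OF H, of X Ts Y Us] here(2) by metis
  qed
next
  case (below t Ts t' Z)
  note c = construct_in_child[OF H below.prems below(1)]
  then have "construct_in H t'" "vertices t' = vertices t" using below.IH by blast+
  from construct_in_replace_child[OF H below.prems below(1) this] show ?case by blast
qed

text \<open>One filling function serves before and after the contraction, so the two constructions
  differ only in the order in which \<open>X \<union> Y\<close> is eliminated. The labels
  \<open>X\<close> and \<open>Y\<close> are not compared here, which makes the lemma apply to
  fusions and splits alike.\<close>

lemma contract_root_decr:
  assumes "contract_root X Y S T" and S: "construct_in H S" and G: "conn H (vertices S)"
  obtains f where "decr H S = elim H f (desc X @ desc Y) (vertices S)"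
    and "decr H T = elim H f (desc (X \<union> Y)) (vertices S)"
    and "X \<noteq> {}" "Y \<noteq> {}" "finite X" "finite Y" "X \<union> Y \<subseteq> vertices S"
    and "\<And>C. C \<in> comps H (vertices S - (X \<union> Y)) \<Longrightarrow> construction_on H C (f C)"
  using assms(1)
proof cases
  case (1 Us Ts)
  define A where "A = (Ts |-| {|Node Y Us|}) |\<union>| Us"
  note m = contract_root_construct_in[OF H S[unfolded 1] 1(3) A_def]
  obtain f where f: "\<And>t. t \<in> fset A \<Longrightarrow> f (vertices t) = decr H t"
    using ex_child_function[OF H m(1), of "decr H"] by blast
  have YU: "construct_in H (Node Y Us)" using construct_in_child(1)[OF H S[unfolded 1(1)] 1(3)] .
  show thesis
  proof (rule that[of f])
    show "decr H S = elim H f (desc X @ desc Y) (vertices S)"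
      unfolding 1(1) using G[unfolded 1(1)] f by (rule m(3))
    have T: "T = Node (X \<union> Y) A" using 1(2) by (simp add: A_def)
    show "decr H T = elim H f (desc (X \<union> Y)) (vertices S)"
      unfolding T 1(1) m(2)[symmetric]
      by (rule decr_Node[OF H m(1) _ f]) (use G m(2) 1(1) in \<open>simp only:\<close>)
    show "X \<noteq> {}" "Y \<noteq> {}" using S YU unfolding 1(1) construct_in_Node[OF H] by blast+
    show "finite X" "finite Y"
      using construct_in_finite[OF H] S[unfolded 1(1)] YU by blast+
    show "X \<union> Y \<subseteq> vertices S" unfolding 1(1) m(2)[symmetric] unfolding vertices_Node by blast
    fix C assume C: "C \<in> comps H (vertices S - (X \<union> Y))"
    then have "C \<in> comps H (vertices (Node (X \<union> Y) A) - (X \<union> Y))" unfolding m(2) 1(1) .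
    then obtain t where t: "t \<in> fset A" "vertices t = C" by (rule comps_child[OF H m(1)])
    then show "construction_on H C (f C)"
      using construction_on_decr[OF H] construct_in_child[OF H m(1) t(1)] f[OF t(1)] by metis
  qed
qed

text \<open>The two filling functions differ only at the vertex set of \<open>t\<close>, so equality
  carries over at once and paths of flips by \<open>flip_steps_elim\<close>. The path leads from the
  new tree back to the old one, because a split is read as a contraction in reverse.\<close>

lemma decr_replace_child:
  assumes S: "construct_in H (Node Z Ts)" and G: "conn H (vertices (Node Z Ts))"
    and t: "t \<in> fset Ts" and t': "construct_in H t'" "vertices t' = vertices t"
  defines "T \<equiv> Node Z (finsert t' (Ts |-| {|t|}))"
  shows "decr H t' = decr H t \<Longrightarrow> decr H T = decr H (Node Z Ts)"
    and "(flip_step H)\<^sup>+\<^sup>+ (decr H t') (decr H t) \<Longrightarrow>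
      (flip_step H)\<^sup>+\<^sup>+ (decr H T) (decr H (Node Z Ts))"
proof -
  note T = construct_in_replace_child[OF H S t t', folded T_def]
  obtain f where f: "\<And>s. s \<in> fset Ts \<Longrightarrow> f (vertices s) = decr H s"
    using ex_child_function[OF H S, of "decr H"] by blast
  define f' where "f' = f(vertices t := decr H t')"
  have "inj_on vertices (fset Ts)" using S unfolding construct_in_Node[OF H] bij_betw_def by blast
  then have ne: "vertices s \<noteq> vertices t" if "s \<in> fset Ts" "s \<noteq> t" for s
    using that t unfolding inj_on_def by blast
  have f': "f' (vertices s) = decr H s" if "s \<in> fset (finsert t' (Ts |-| {|t|}))" for s
  proof (cases "s = t'")
    case True
    then show ?thesis by (simp only: f'_def t'(2) fun_upd_same)
  next
    case False
    then have "s \<in> fset Ts" "s \<noteq> t" using that by simp_all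
    then show ?thesis unfolding f'_def using f[of s] ne[of s] fun_upd_other by metis
  qed
  have e: "decr H (Node Z Ts) = elim H f (desc Z) (vertices (Node Z Ts))"
    by (rule decr_Node[OF H S G f])
  have e': "decr H T = elim H f' (desc Z) (vertices (Node Z Ts))"
    unfolding T(2)[symmetric] unfolding T_def
    by (rule decr_Node[OF H T(1)[unfolded T_def] _ f'])
      (unfold T(2)[unfolded T_def], rule G)
  \<comment> \<open>The original filling function is an update of the new one, which is the shape
    \<open>flip_steps_elim\<close> produces.\<close>
  have f_t: "f = f'(vertices t := decr H t)"
    unfolding f'_def fun_upd_upd f[OF t, symmetric] fun_upd_triv ..
  show "decr H T = decr H (Node Z Ts)" if "decr H t' = decr H t"
    unfolding e e' f'_def that f[OF t, symmetric] fun_upd_triv ..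
  assume *: "(flip_step H)\<^sup>+\<^sup>+ (decr H t') (decr H t)"
  have "(flip_step H)\<^sup>+\<^sup>+ (elim H f' (desc Z) (vertices (Node Z Ts)))
      (elim H (f'(vertices t := decr H t)) (desc Z) (vertices (Node Z Ts)))"
  proof (rule flip_steps_elim[OF H _ G])
    show "(flip_step H)\<^sup>+\<^sup>+ (f' (vertices t)) (decr H t)" using * by (simp add: f'_def)
    have s: "set (desc Z) = Z" using construct_in_finite[OF H S] by simp
    show "vertices t \<in> comps H (vertices (Node Z Ts) - set (desc Z))"
      unfolding s by (rule construct_in_child(3)[OF H S t])
    fix C assume C: "C \<in> comps H (vertices (Node Z Ts) - set (desc Z))"
    then have "C \<in> comps H (vertices T - Z)" unfolding s T(2) .
    then obtain r where r: "r \<in> fset (finsert t' (Ts |-| {|t|}))" "vertices r = C"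
      by (rule comps_child[OF H T(1)[unfolded T_def], folded T_def])
    then show "construction_on H C (f' C)"
      using construction_on_decr[OF H] construct_in_child[OF H T(1)[unfolded T_def] r(1)] f'[OF r(1)]
      by metis
  qed
  then show "(flip_step H)\<^sup>+\<^sup>+ (decr H T) (decr H (Node Z Ts))" unfolding e e' f_t[symmetric] .
qed

lemma decr_fusion:
  assumes "contracts U V S T" "set_less V U" "construct_in H S" "conn H (vertices S)"
  shows "decr H T = decr H S"
  using assms(1,3,4) unfolding contracts_def
proof (induction rule: at_subtree.induct)
  case (here t t')
  obtain f where f: "decr H t = elim H f (desc U @ desc V) (vertices t)"
    "decr H t' = elim H f (desc (U \<union> V)) (vertices t)"
    "U \<noteq> {}" "V \<noteq> {}" "finite U" "finite V"
    by (rule contract_root_decr[OF here], rule that)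
  show ?case unfolding f(1,2) Un_commute[of U V] desc_Un[OF f(5,6,3,4) assms(2)] ..
next
  case (below t Ts t' Z)
  note c = construct_in_child[OF H below.prems(1) below(1)]
  have t': "construct_in H t'" "vertices t' = vertices t"
    using contracts_construct_in[unfolded contracts_def] below(2) c(1) by blast+
  show ?case
    using decr_replace_child(1)[OF below.prems below(1) t'] below.IH c by blast
qed

text \<open>Here \<open>S\<close> is the finer tree, obtained from \<open>T\<close> by the split. At
  the contracted edge \<open>T\<close> eliminates \<open>U\<close> before \<open>V\<close> and
  \<open>S\<close> eliminates \<open>V\<close> before \<open>U\<close>, so the path of flips
  interchanges these two blocks.\<close>

lemma decr_split:
  assumes "contracts V U S T" "set_less V U" "construct_in H S" "conn H (vertices S)"
  shows "(flip_step H)\<^sup>+\<^sup>+ (decr H T) (decr H S)"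
  using assms(1,3,4) unfolding contracts_def
proof (induction rule: at_subtree.induct)
  case (here t t')
  obtain f where f: "decr H t = elim H f (desc V @ desc U) (vertices t)"
    "decr H t' = elim H f (desc (V \<union> U)) (vertices t)"
    "V \<noteq> {}" "U \<noteq> {}" "finite V" "finite U" "V \<union> U \<subseteq> vertices t"
    "\<And>C. C \<in> comps H (vertices t - (V \<union> U)) \<Longrightarrow> construction_on H C (f C)"
    by (rule contract_root_decr[OF here], rule that)
  have l: "v < u" if "v \<in> V" "u \<in> U" for u v
    using assms(2) Max_ge[OF f(5) that(1)] Min_le[OF f(6) that(2)]
    unfolding set_less_def by (meson le_less_trans less_le_trans)
  have s: "set (desc U) = U" "set (desc V) = V" using f(5,6) by simp_all
  have su: "set (desc U @ desc V) = V \<union> U" unfolding set_append s by blast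
  show ?case
    unfolding f(1,2) desc_Un[OF f(6,5,4,3) assms(2)]
  proof (rule flip_steps_elim_swap[OF H _ here.prems(2)], unfold su s)
    show "desc U \<noteq> []" "desc V \<noteq> []" using f(3-6) by simp_all
  qed (use l f(7,8) in blast)+
next
  case (below t Ts t' Z)
  note c = construct_in_child[OF H below.prems(1) below(1)]
  have t': "construct_in H t'" "vertices t' = vertices t"
    using contracts_construct_in[unfolded contracts_def] below(2) c(1) by blast+
  show ?case
    using decr_replace_child(2)[OF below.prems below(1) t'] below.IH c by blast
qed

section \<open>A flip as a fusion followed by a split\<close>

text \<open>Both trees contract to the one with root \<open>{x, y}\<close> and children
  \<open>A\<close>, since the flip only redistributes \<open>A\<close> between \<open>x\<close> and
  \<open>y\<close>.\<close>

lemma flip_root_contract_root: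
  assumes "flip_root H x y t t'" and t: "construct_in H t"
  obtains t'' where "contract_root {x} {y} t t''" "contract_root {y} {x} t' t''"
    and "vertices t' = vertices t"
  using assms(1)
proof cases
  case (1 Us Ts A P K B)
  note c = construct_in_child[OF H t[unfolded 1(1)] 1(3)]
  note m = contract_root_construct_in[OF H t[unfolded 1(1)] 1(3,4)]
  have A1: "contract_root {x} {y} t (Node ({x} \<union> {y}) A)"
    unfolding 1(1,4) by (rule contract_root.intros[OF 1(3)])
  have BA: "fset B \<subseteq> fset A" using 1(8) by auto
  \<comment> \<open>The vertex \<open>x\<close> belongs to the root of the contracted tree and so to
    none of its children. Thus removing the new child \<open>x\<close> does not remove a member of
    \<open>A\<close>.\<close>
  have "Node {x} B \<notin> fset A"
  proof
    assume a: "Node {x} B \<in> fset A"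
    have W: "vertices (Node ({x} \<union> {y}) A) - ({x} \<union> {y}) \<subseteq> \<Union>H"
      using m(1) unfolding construct_in_def by blast
    have "vertices (Node {x} B) \<subseteq> vertices (Node ({x} \<union> {y}) A) - ({x} \<union> {y})"
      by (rule comps_subset[OF H W construct_in_child(3)[OF H m(1) a]])
    then show False unfolding vertices_Node[of "{x}"] by blast
  qed
  then have e: "(finsert (Node {x} B) (A |-| B) |-| {|Node {x} B|}) |\<union>| B = A"
    using BA by auto
  have A2: "contract_root {y} {x} t' (Node ({y} \<union> {x}) A)"
    using contract_root.intros[of "{x}" B "finsert (Node {x} B) (A |-| B)" "{y}"]
    unfolding e 1(2) by simp
  have "vertices t' = {y} \<union> ({x} \<union> (\<Union>s\<in>fset B. vertices s) \<union> (\<Union>s\<in>fset A - fset B. vertices s))"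
    unfolding 1(2) by (simp add: vertices_Node)
  also have "\<dots> = ({x} \<union> {y}) \<union> (\<Union>s\<in>fset A. vertices s)" using BA by blast
  also have "\<dots> = vertices t" unfolding 1(1) m(2)[symmetric] unfolding vertices_Node ..
  finally have "vertices t' = vertices t" .
  with A1 A2[unfolded Un_commute[of "{y}"]] show thesis by (rule that)
qed

lemma is_flip_contracts:
  assumes "is_flip H x y S T" "construct_in H S"
  shows "vertices T = vertices S \<and> (\<exists>R. contracts {x} {y} S R \<and> contracts {y} {x} T R)"
  using assms unfolding is_flip_def
proof (induction rule: at_subtree.induct)
  case (here t t')
  then show ?case using flip_root_contract_root[of x y t t'] unfolding contracts_def
    by (metis at_subtree.here)
next
  case (below t Ts t' Z)
  note c = construct_in_child[OF H below.prems below(1)]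
  obtain r where r: "contracts {x} {y} t r" "contracts {y} {x} t' r"
    and v: "vertices t' = vertices t"
    using below.IH c(1) by blast
  have 1: "contracts {x} {y} (Node Z Ts) (Node Z (finsert r (Ts |-| {|t|})))"
    using r(1) below(1) unfolding contracts_def by (intro at_subtree.below)
  have "inj_on vertices (fset Ts)"
    using below.prems unfolding construct_in_Node[OF H] bij_betw_def by blast
  \<comment> \<open>The tree \<open>t'\<close> has the vertex set of \<open>t\<close>, which no
    sibling of \<open>t\<close> shares. Deleting it from the new children therefore leaves exactly
    the siblings.\<close>
  then have "t' \<notin> fset Ts - {t}" using below(1) v unfolding inj_on_def by blast
  then have e: "finsert t' (Ts |-| {|t|}) |-| {|t'|} = Ts |-| {|t|}" by auto
  have 2: "contracts {y} {x} (Node Z (finsert t' (Ts |-| {|t|}))) (Node Z (finsert r (Ts |-| {|t|})))"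
    using at_subtree.below[of t' "finsert t' (Ts |-| {|t|})" _ r Z] r(2)
    unfolding contracts_def e by blast
  have "fset Ts = insert t (fset Ts - {t})" using below(1) by blast
  then have "(\<Union>s\<in>fset Ts. vertices s) = vertices t \<union> (\<Union>s\<in>fset Ts - {t}. vertices s)"
    by (metis UN_insert)
  then have "vertices (Node Z (finsert t' (Ts |-| {|t|}))) = vertices (Node Z Ts)"
    unfolding vertices_Node by (simp add: v)
  then show ?case using 1 2 by blast
qed

section \<open>Comparing the transitive closures\<close>

lemma construction_iff: "construction H S \<longleftrightarrow> construction_on H (\<Union>H) S"
  unfolding construction_def construction_on_def construct_iff[OF H] by blast

lemma flip_step_flip_less:
  assumes "flip_step H S T" "construction H S"
  shows "flip_less H S T"
proof -
  obtain G where G: "construction_on H G S" "construction_on H G T"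
    and f: "\<exists>x y. y < x \<and> is_flip H x y S T"
    using assms(1) unfolding flip_step_def by blast
  have "G = \<Union>H"
    using assms(2) G(1) unfolding construction_iff construction_on_def by blast
  then have "construction H T" using G(2) construction_iff by blast
  then show ?thesis using assms(2) f unfolding flip_less_def by blast
qed

lemma flip_steps_flip_less:
  assumes "(flip_step H)\<^sup>+\<^sup>+ S T" "construction H S"
  shows "(flip_less H)\<^sup>+\<^sup>+ S T"
proof -
  have "construction H T \<and> (flip_less H)\<^sup>+\<^sup>+ S T"
    using assms(1)
  proof (induction rule: tranclp_induct)
    case (base T)
    then have "flip_less H S T" using flip_step_flip_less assms(2) by blast
    then show ?case by (meson flip_less_def tranclp.r_into_trancl)
  next
    case (step R T)
    then have *: "flip_less H R T" using flip_step_flip_less by blast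
    then have "construction H T" unfolding flip_less_def by blast
    with * show ?case using step.IH by (meson tranclp.trancl_into_trancl)
  qed
  then show ?thesis ..
qed

lemma flip_less_construct_less:
  assumes "flip_less H S T" shows "(construct_less H)\<^sup>+\<^sup>+ S T"
proof -
  from assms obtain x y where S: "construction H S" and T: "construction H T"
    and xy: "y < x" "is_flip H x y S T" unfolding flip_less_def by blast
  have c: "construct_in H S" "vertices S = \<Union>H" "construct H S" "construct H T"
    using S T unfolding construction_def construct_iff[OF H] by blast+
  obtain R where R: "contracts {x} {y} S R" "contracts {y} {x} T R"
    using is_flip_contracts[OF xy(2) c(1)] by blast
  have "construct H R" using contracts_construct_in[OF R(1) c(1)] c(2) construct_iff[OF H] by auto
  moreover have "set_less {y} {x}" using xy(1) by (simp add: set_less_def)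
  ultimately have "construct_less H S R" "construct_less H R T"
    using R c(3,4) unfolding construct_less_def by blast+
  then show ?thesis by (meson tranclp.intros)
qed

text \<open>The merged label has at least two elements. This shows that a step into a construction
  cannot be a fusion.\<close>

lemma contracts_not_construction:
  assumes "contracts U V S T" "set_less V U" "construct_in H S"
  shows "\<not> (\<forall>X\<in>nodes T. is_singleton X)"
proof -
  have "\<exists>X\<in>nodes T. \<not> is_singleton X" using assms(1,3) unfolding contracts_def
  proof (induction rule: at_subtree.induct)
    case (here t t')
    from here(1) show ?case
    proof cases
      case (1 Us Ts)
      have "U \<noteq> {}" "V \<noteq> {}"
        using here(2) construct_in_child(1)[OF H here(2)[unfolded 1(1)] 1(3)]
        unfolding 1(1) construct_in_Node[OF H] by blast+
      \<comment> \<open>If the union of two non-empty sets is a singleton, both equal it, which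
        \<open>set_less V U\<close> excludes.\<close>
      moreover have "\<not> (U = {z} \<and> V = {z})" for z using assms(2) by (auto simp: set_less_def)
      ultimately have "\<not> is_singleton (U \<union> V)" unfolding is_singleton_def
        by (auto simp: Un_singleton_iff)
      then show ?thesis unfolding 1(2) nodes_Node by blast
    qed
  next
    case (below t Ts t' Z)
    then show ?case using construct_in_child(1)[OF H below.prems below(1)] by (auto simp: nodes_Node)
  qed
  then show ?thesis by blast
qed

lemma construct_less_flip_less:
  assumes "(construct_less H)\<^sup>+\<^sup>+ S T" "connected_hg H" "construction H S" "construction H T"
  shows "(flip_less H)\<^sup>+\<^sup>+ S T"
proof -
  have G: "conn H (vertices R)" "construct_in H R" if "construct H R" for R
  proof -
    show R: "construct_in H R" using that construct_iff[OF H] by blast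
    have v: "vertices R = \<Union>H" using that construct_iff[OF H] by blast
    have "vertices R \<noteq> {}"
      using R by (cases R) (auto simp: construct_in_Node[OF H] vertices_Node)
    then show "conn H (vertices R)" using assms(2) unfolding v by (simp add: conn_def)
  qed
  have dec: "decr H R = R" if "construction H R" for R
  proof -
    have "construct H R" "construction_on H (vertices R) R"
      using that construction_iff[of R] unfolding construction_def construction_on_def by blast+
    then show ?thesis using decr_construction[OF H] G by blast
  qed
  \<comment> \<open>A fusion gives the equality, a split the path of flips.\<close>
  have less_step: "decr H R = decr H R' \<or> (flip_step H)\<^sup>+\<^sup>+ (decr H R) (decr H R')"
    if "construct_less H R R'" for R R'
    using that decr_fusion[of _ _ R R'] decr_split[of _ _ R' R] G
    unfolding construct_less_def by metis
  \<comment> \<open>As \<open>T\<close> is a construction, the step into it is a split and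
    contributes at least one flip.\<close>
  have strict: "(flip_step H)\<^sup>+\<^sup>+ (decr H R) (decr H T)" if "construct_less H R T" for R
    using that decr_split[of _ _ T R] contracts_not_construction[of _ _ R T] G assms(4)
    unfolding construct_less_def construction_def by metis
  obtain R where R: "(construct_less H)\<^sup>*\<^sup>* S R" "construct_less H R T"
    using assms(1) by (metis tranclp.cases tranclp_into_rtranclp rtranclp.rtrancl_refl)
  have "(flip_step H)\<^sup>*\<^sup>* (decr H S) (decr H R)"
    using R(1)
  proof (induction rule: rtranclp_induct)
    case (step R R')
    then show ?case using less_step[OF step(2)]
      by (metis tranclp_into_rtranclp rtranclp_trans)
  qed simp
  then have "(flip_step H)\<^sup>+\<^sup>+ (decr H S) (decr H T)"
    using strict[OF R(2)] by (rule rtranclp_tranclp_tranclp)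
  then show ?thesis using flip_steps_flip_less dec assms(3,4) by metis
qed

end

theorem proposition2p30:
  fixes H :: "'a::linorder set set" and S T :: "'a ctree"
  assumes "hypergraph H" and "connected_hg H"
    and "construction H S" and "construction H T"
  shows "(flip_less H S T \<longrightarrow> (construct_less H)\<^sup>+\<^sup>+ S T) \<and>
         (hereditarily_ordered H \<and> (construct_less H)\<^sup>+\<^sup>+ S T \<longrightarrow> (flip_less H)\<^sup>+\<^sup>+ S T)"
  using flip_less_construct_less[OF assms(1)] construct_less_flip_less[OF assms(1) _ assms(2-4)]
  by blast

end
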